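(* Let $p_0>1$ and $\tau>0$ be constants, let $p=p(n)=p_0\frac{\log n}{n}$ (for $n$ large enough that $p(n)\le1$), and let $H_n$ be the Laplacian matrix of the Erdős–Rényi random graph $G(n,p(n))$. Let $W_0$ and $W_{-1}$ be the two real branches of the Lambert $W$ function. Then: 1. if $\tau<\dfrac{W_0\left(\frac{1-p_0}{\mathrm{e}\,p_0}\right)}{1-p_0}$, then there is a constant $C\in(0,1)$ such that asymptotically almost surely $S(\varrho_{H_n}^\tau)\ge C\log n+o(1)$; 2. if $\tau>\dfrac{W_{-1}\left(\frac{1-p_0}{\mathrm{e}\,p_0}\right)}{1-p_0}$, then asymptotically almost surely $S(\varrho_{H_n}^\tau)=o(1)$.
   Context: The Erdős–Rényi random graph $G(n,p)$ is the random simple undirected graph on $n$ vertices in which each pair of distinct vertices is adjacent independently with probability $p$. The Laplacian of a simple graph is $L=D-A$, where $A$ is the adjacency matrix and $D$ the diagonal matrix of vertex degrees. For a Hermitian matrix $H$ and real $\tau$, the Gibbs state is $\varrho_H^\tau=\exp(-\tau H)/Z$ with $Z=\mathrm{Tr}(\exp(-\tau H))$. The von Neumann entropy of a density matrix $\varrho$ is $S(\varrho)=-\mathrm{Tr}(\varrho\log\varrho)$, with $\log$ the natural logarithm. For $x\in(-1/\mathrm{e},0)$, $W_0(x)\in(-1,0)$ and $W_{-1}(x)\in(-\infty,-1)$ are the two real solutions $w$ of $w\mathrm{e}^w=x$. "Asymptotically almost surely $S\geq C\log n+o(1)$" means: there is a deterministic sequence $\varepsilon_n\to0$ with $\Pr(S\ge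 C\log n+\varepsilon_n)\to1$ as $n\to\infty$; "asymptotically almost surely $S=o(1)$" means: there is a deterministic sequence $\varepsilon_n\to 0$ with $\Pr(|S|\le\varepsilon_n)\to1$. The constant $C$ may depend on $p_0$ and $\tau$. *)

theory Defs
  imports
    "HOL-Probability.Probability"
    "Jordan_Normal_Form.Schur_Decomposition"
begin

subsection \<open>Random graphs and their Laplacians\<close>

text \<open>A simple graph on the vertex set \<open>{..<n}\<close> is given by its edge set, a subset of
  \<open>vertex_pairs n\<close>.\<close>

definition vertex_pairs :: "nat \<Rightarrow> nat set set" where
  "vertex_pairs n = {e. e \<subseteq> {..<n} \<and> card e = 2}"

text \<open>\<^const>\<open>bernoulli_pmf\<close> clamps its parameter to \<open>[0,1]\<close>, so only \<open>p \<in> [0,1]\<close> is meaningful.\<close>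

definition erdos_renyi :: "nat \<Rightarrow> real \<Rightarrow> nat set set pmf" where
  "erdos_renyi n p =
     map_pmf (\<lambda>f. {e \<in> vertex_pairs n. f e})
       (Pi_pmf (vertex_pairs n) False (\<lambda>_. bernoulli_pmf p))"

definition adjacency_mat :: "nat \<Rightarrow> nat set set \<Rightarrow> complex mat" where
  "adjacency_mat n E = Matrix.mat n n (\<lambda>(i, j). if {i, j} \<in> E then 1 else 0)"

definition degree_mat :: "nat \<Rightarrow> nat set set \<Rightarrow> complex mat" where
  "degree_mat n E = mat_diag n (\<lambda>i. of_nat (card {e \<in> E. i \<in> e}))"

definition laplacian_mat :: "nat \<Rightarrow> nat set set \<Rightarrow> complex mat" where
  "laplacian_mat n E = degree_mat n E - adjacency_mat n E"

subsection \<open>Gibbs states and von Neumann entropy\<close>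

definition mat_trace :: "complex mat \<Rightarrow> complex" where
  "mat_trace A = (\<Sum>i<dim_row A. A $$ (i, i))"

definition mat_exp :: "complex mat \<Rightarrow> complex mat" where
  "mat_exp A = Matrix.mat (dim_row A) (dim_row A)
     (\<lambda>(i, j). \<Sum>k. (A ^\<^sub>m k) $$ (i, j) / fact k)"

text \<open>\<open>A = U diag(d) U\<^sup>*\<close> with \<open>U\<close> unitary and \<open>d\<close> real.\<close>

definition spectral_decomp :: "complex mat \<Rightarrow> complex mat \<Rightarrow> (nat \<Rightarrow> real) \<Rightarrow> bool" where
  "spectral_decomp A U d \<longleftrightarrow>
     (let n = dim_row A in
      U \<in> carrier_mat n n \<and> U * mat_adjoint U = 1\<^sub>m n \<and> mat_adjoint U * U = 1\<^sub>m n \<and>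
      A = U * mat_diag n (\<lambda>i. complex_of_real (d i)) * mat_adjoint U)"

text \<open>Functional calculus \<open>f(A) = U diag(f(d)) U\<^sup>*\<close>. For Hermitian \<open>A\<close> a decomposition exists and
  the result does not depend on which one is chosen; for other \<open>A\<close> the value is unspecified.\<close>

definition mat_fun :: "(real \<Rightarrow> real) \<Rightarrow> complex mat \<Rightarrow> complex mat" where
  "mat_fun f A = (SOME B. \<exists>U d. spectral_decomp A U d \<and>
     B = U * mat_diag (dim_row A) (\<lambda>i. complex_of_real (f (d i))) * mat_adjoint U)"

text \<open>As \<open>ln 0 = 0\<close> in HOL, \<open>\<rho> * mat_log \<rho>\<close> respects the convention \<open>0 log 0 = 0\<close> for
  singular density matrices.\<close>

definition mat_log :: "complex mat \<Rightarrow> complex mat" where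
  "mat_log = mat_fun ln"

definition gibbs_state :: "real \<Rightarrow> complex mat \<Rightarrow> complex mat" where
  "gibbs_state \<tau> H =
     (let K = mat_exp (complex_of_real (- \<tau>) \<cdot>\<^sub>m H) in (1 / mat_trace K) \<cdot>\<^sub>m K)"

text \<open>The trace is real for density matrices; \<^const>\<open>Re\<close> only adjusts the type.\<close>

definition von_neumann_entropy :: "complex mat \<Rightarrow> real" where
  "von_neumann_entropy \<rho> = - Re (mat_trace (\<rho> * mat_log \<rho>))"

subsection \<open>Real branches of the Lambert W function\<close>

text \<open>Both are used for arguments in \<open>(-1/e, 0)\<close> only, where the solutions exist and are unique.\<close>

definition lambert_W0 :: "real \<Rightarrow> real" where
  "lambert_W0 x = (THE w. -1 < w \<and> w < 0 \<and> w * exp w = x)"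

definition lambert_Wm1 :: "real \<Rightarrow> real" where
  "lambert_Wm1 x = (THE w. w < -1 \<and> w * exp w = x)"

end

theory Submission
  imports Defs "HOL-Real_Asymp.Real_Asymp"
begin

text \<open>
  Write \<open>L = ln n\<close>. Diagonalising the Laplacian as \<open>U diag(d) U\<^sup>*\<close> turns the entropy into
  \<open>ln Z + \<tau> (\<Sum>i. d\<^sub>i e\<^bsup>-\<tau> d\<^sub>i\<^esup>) / Z\<close> with \<open>Z = \<Sum>i. e\<^bsup>-\<tau> d\<^sub>i\<^esup>\<close> (\<open>gibbs_entropy_eq\<close>), so both parts are
  statements about eigenvalues.

  For small \<open>\<tau>\<close> the entropy is at least \<open>ln Z\<close>, and by Jensen's inequality \<open>Z\<close> is at least
  \<open>n e\<^bsup>-\<tau> m\<^esup>\<close> for the mean eigenvalue \<open>m\<close>, which is the mean degree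
  (\<open>laplacian_entropy_ge\<close>). The mean degree concentrates at \<open>p\<^sub>0 L\<close>, and the threshold given by \<open>W\<^sub>0\<close>
  implies \<open>\<tau> p\<^sub>0 < 1\<close> (\<open>lambert_W0_threshold\<close>); hence \<open>S \<ge> C L\<close> with high probability for every
  \<open>C < 1 - \<tau> p\<^sub>0\<close>.

  For large \<open>\<tau>\<close> one shows that the eigenvalue \<open>0\<close> is simple and that all others are at least \<open>g L\<close>
  with \<open>\<tau> g > 1\<close>. The entropy is then at most \<open>n\<^bsup>1-\<tau> g\<^esup> (1 + \<tau> g L)\<close>
  (\<open>laplacian_entropy_le\<close>). The constant \<open>c\<^sub>0 = (1 - p\<^sub>0) / W\<^sub>-\<^sub>1\<close> is that of the minimum degree: by Chernoff's
  bound no vertex has degree below \<open>c L\<close>, for any \<open>c < c\<^sub>0\<close> (\<open>min_degree\<close>,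
  \<open>lambert_Wm1_threshold\<close>). On vectors orthogonal to the constants, the Laplacian form is the degree form
  minus the form of the centred adjacency matrix, so it remains to see that the latter has norm at most
  \<open>\<eta> L\<close> for every \<open>\<eta> > 0\<close>. This is far weaker than the true order \<open>\<surd>L\<close>, and it follows from a converse of
  the expander mixing lemma in the manner of Bilu and Linial (\<open>quadratic_form_le\<close>): if all
  rectangles \<open>S \<times> T\<close> have discrepancy at most \<open>\<alpha> \<surd>(|S| |T|)\<close> and all absolute row sums are at most \<open>\<Delta>\<close>, then the norm is
  at most a constant times \<open>\<alpha> \<gamma> + \<Delta> 2\<^bsup>-\<gamma>\<^esup>\<close> for each \<open>\<gamma> \<ge> 1\<close>. Here \<open>\<Delta>\<close> is of order \<open>L\<close>, so a fixed large
  \<open>\<gamma>\<close> and then \<open>\<alpha> = \<eta>' L\<close> with a small constant \<open>\<eta>'\<close> suffice. The discrepancy itself (\<open>discrepancy\<close>) is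
  trivial from the maximum degree when \<open>|S|\<close> is a small fraction of \<open>|T|\<close>, and otherwise is a Chernoff
  bound with a union bound over all pairs of sets.
\<close>

section \<open>The two real branches of the Lambert function\<close>

lemma mult_exp_strict_mono:
  fixes v w :: real
  assumes "-1 \<le> v" "v < w"
  shows "v * exp v < w * exp w"
proof (rule DERIV_pos_imp_increasing_open[OF assms(2)])
  fix x assume "v < x" "x < w"
  then show "\<exists>y. ((\<lambda>w. w * exp w) has_real_derivative y) (at x) \<and> 0 < y"
    using assms(1) by (intro exI[of _ "(1 + x) * exp x"] conjI mult_pos_pos)
      (auto intro!: derivative_eq_intros simp: algebra_simps)
qed (auto intro!: continuous_intros)

lemma mult_exp_strict_antimono:
  fixes v w :: real
  assumes "w \<le> -1" "v < w"
  shows "v * exp v > w * exp w"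
proof (rule DERIV_neg_imp_decreasing_open[OF assms(2)])
  fix x assume "v < x" "x < w"
  then show "\<exists>y. ((\<lambda>w. w * exp w) has_real_derivative y) (at x) \<and> y < 0"
    using assms(1) by (intro exI[of _ "(1 + x) * exp x"] conjI mult_neg_pos)
      (auto intro!: derivative_eq_intros simp: algebra_simps)
qed (auto intro!: continuous_intros)

lemma lambert_W0:
  assumes "- exp (-1) < x" "x < 0"
  shows "-1 < lambert_W0 x \<and> lambert_W0 x < 0 \<and> lambert_W0 x * exp (lambert_W0 x) = x"
  unfolding lambert_W0_def
proof (rule theI')
  have "\<exists>w. -1 \<le> w \<and> w \<le> 0 \<and> w * exp w = x"
    by (rule IVT') (use assms in \<open>auto intro!: continuous_intros\<close>)
  then obtain w where "-1 \<le> w" "w \<le> 0" "w * exp w = x" by blast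
  moreover from this have "w \<noteq> -1" "w \<noteq> 0" using assms by auto
  ultimately show "\<exists>!w. -1 < w \<and> w < 0 \<and> w * exp w = x"
    by (intro ex1I[of _ w]) (auto, smt (verit) mult_exp_strict_mono)
qed

lemma lambert_Wm1:
  assumes "- exp (-1) < x" "x < 0"
  shows "lambert_Wm1 x < -1 \<and> lambert_Wm1 x * exp (lambert_Wm1 x) = x"
  unfolding lambert_Wm1_def
proof (rule theI')
  have "((\<lambda>w::real. w * exp w) \<longlongrightarrow> 0) at_bot" by real_asymp
  then have "eventually (\<lambda>w. w * exp w > x) at_bot" using assms by (simp add: order_tendsto_iff)
  moreover have "eventually (\<lambda>w::real. w \<le> -1) at_bot" by (rule eventually_le_at_bot)
  ultimately have "eventually (\<lambda>w. w * exp w > x \<and> w \<le> -1) at_bot" by eventually_elim auto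
  then obtain v where v: "v * exp v > x" "v \<le> -1"
    by (metis (mono_tags, lifting) eventually_happens trivial_limit_at_bot_linorder)
  have "\<exists>w. v \<le> w \<and> w \<le> -1 \<and> w * exp w = x"
    by (rule IVT2') (use assms v in \<open>auto intro!: continuous_intros\<close>)
  then obtain w where "w \<le> -1" "w * exp w = x" by blast
  moreover from this have "w \<noteq> -1" using assms by auto
  ultimately show "\<exists>!w. w < -1 \<and> w * exp w = x"
    by (intro ex1I[of _ w]) (auto, smt (verit) mult_exp_strict_antimono)
qed

lemma lambert_argument_range:
  fixes p\<^sub>0 :: real
  assumes "p\<^sub>0 > 1"
  shows "- exp (-1) < (1 - p\<^sub>0) / (exp 1 * p\<^sub>0)" "(1 - p\<^sub>0) / (exp 1 * p\<^sub>0) < 0"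
  using assms by (auto simp: exp_minus field_simps)

text \<open>With \<open>w = (1 - p\<^sub>0) / p\<^sub>0\<close> one has \<open>w e\<^sup>w = e\<^bsup>1/p\<^sub>0\<^esup> (1 - p\<^sub>0) / (e p\<^sub>0)\<close>, which lies below the
  argument of \<open>W\<^sub>0\<close>; so the first threshold is below the reciprocal of the mean degree constant.\<close>

lemma lambert_W0_threshold:
  fixes p\<^sub>0 \<tau> :: real
  assumes "p\<^sub>0 > 1" "\<tau> < lambert_W0 ((1 - p\<^sub>0) / (exp 1 * p\<^sub>0)) / (1 - p\<^sub>0)"
  shows "\<tau> * p\<^sub>0 < 1"
proof -
  define x where "x = (1 - p\<^sub>0) / (exp 1 * p\<^sub>0)"
  define w where "w = lambert_W0 x"
  have w: "-1 < w" "w < 0" "w * exp w = x"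
    using lambert_W0[of x] lambert_argument_range[OF assms(1)] by (auto simp: x_def w_def)
  define w1 where "w1 = (1 - p\<^sub>0) / p\<^sub>0"
  have "exp (w1 + 1) > 1" using assms(1) by (simp add: w1_def field_simps)
  then have "exp w1 > exp (-1)" by simp
  then have "w1 * exp w1 < w1 * exp (-1)"
    using assms(1) by (intro mult_strict_left_mono_neg) (auto simp: w1_def field_simps)
  also have "\<dots> = w * exp w" unfolding w(3) by (simp add: x_def w1_def exp_minus field_simps)
  finally have "w1 < w"
    using mult_exp_strict_mono[of w w1] w(1) by (cases w w1 rule: linorder_cases) auto
  moreover have "\<tau> * (1 - p\<^sub>0) > w"
    using assms unfolding w_def x_def by (simp add: field_simps)
  ultimately have "w1 < \<tau> * (1 - p\<^sub>0)" by simp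
  then have "(1 - p\<^sub>0) * (1 / p\<^sub>0) < (1 - p\<^sub>0) * \<tau>" by (simp add: w1_def mult.commute)
  then have "\<tau> < 1 / p\<^sub>0" using assms(1) by (subst (asm) mult_less_cancel_left_neg) auto
  then show ?thesis using assms(1) by (simp add: field_simps)
qed

text \<open>The number \<open>c\<^sub>0 = (1 - p\<^sub>0) / W\<^sub>-\<^sub>1\<close> is the constant of the minimum degree: it solves
  \<open>p\<^sub>0 - c + c ln (c / p\<^sub>0) = 1\<close>, and below it the left-hand side exceeds \<open>1\<close>.\<close>

lemma lambert_Wm1_threshold:
  fixes p\<^sub>0 \<tau> :: real
  assumes "p\<^sub>0 > 1" "\<tau> > lambert_Wm1 ((1 - p\<^sub>0) / (exp 1 * p\<^sub>0)) / (1 - p\<^sub>0)"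
  obtains c where "0 < c" "c < p\<^sub>0" "\<tau> * c > 1" "1 + c * ln (p\<^sub>0 / c) - p\<^sub>0 + c < 0"
proof -
  define x where "x = (1 - p\<^sub>0) / (exp 1 * p\<^sub>0)"
  define w where "w = lambert_Wm1 x"
  have w: "w < -1" "w * exp w = x"
    using lambert_Wm1[of x] lambert_argument_range[OF assms(1)] by (auto simp: x_def w_def)
  have "\<tau> * (1 - p\<^sub>0) < w"
    using assms unfolding w_def x_def by (simp add: field_simps)
  then obtain v where v: "\<tau> * (1 - p\<^sub>0) < v" "v < w" using dense by blast
  define c where "c = (1 - p\<^sub>0) / v"
  have v1: "v < -1" using v w by simp
  have c0: "c > 0" using v1 assms(1) by (simp add: c_def divide_neg_neg)
  have "(p\<^sub>0 - 1) * 1 < (p\<^sub>0 - 1) * (- v)" using v1 assms(1) by (intro mult_strict_left_mono) auto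
  then have "c < p\<^sub>0 - 1" using v1 by (simp add: c_def field_simps)
  then have "c < p\<^sub>0" by simp
  moreover have "\<tau> * c > 1" using v(1) v1 by (simp add: c_def field_simps)
  moreover have "1 + c * ln (p\<^sub>0 / c) - p\<^sub>0 + c < 0"
  proof -
    have "v * exp v > x" using mult_exp_strict_antimono[of w v] v w by simp
    then have "v * exp v * p\<^sub>0 / (1 - p\<^sub>0) < x * p\<^sub>0 / (1 - p\<^sub>0)"
      by (rule divide_strict_right_mono_neg[OF mult_strict_right_mono]) (use assms(1) in auto)
    also have "\<dots> = exp (-1)" using assms(1) by (simp add: x_def exp_minus field_simps)
    finally have "exp v * (p\<^sub>0 / c) < exp (-1)" using v1 by (simp add: c_def field_simps)
    then have "p\<^sub>0 / c < exp (- 1 - v)" by (simp add: exp_diff field_simps)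
    then have "ln (p\<^sub>0 / c) < - 1 - v"
      using c0 assms(1) by (intro ln_less_cancel_iff[THEN iffD2, of _ "exp (- 1 - v)", simplified]) auto
    then have "c * ln (p\<^sub>0 / c) < c * (- 1 - v)" using c0 by simp
    also have "\<dots> = p\<^sub>0 - 1 - c" using v1 by (simp add: c_def field_simps)
    finally show ?thesis by simp
  qed
  ultimately show ?thesis using that[of c] c0 by simp
qed

section \<open>The spectral theorem and functional calculus for Hermitian matrices\<close>

lemma mat_adjoint_dim [simp]: "dim_row (mat_adjoint A) = dim_col A" "dim_col (mat_adjoint A) = dim_row A"
  by (auto simp: mat_adjoint_def mat_of_rows_def)

lemma mat_adjoint_index [simp]:
  fixes A :: "complex mat"
  shows "i < dim_col A \<Longrightarrow> j < dim_row A \<Longrightarrow> mat_adjoint A $$ (i,j) = cnj (A $$ (j,i))"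
  by (auto simp: mat_adjoint_def mat_of_rows_def)

lemma mat_adjoint_carrier [simp, intro]:
  "A \<in> carrier_mat n m \<Longrightarrow> mat_adjoint A \<in> carrier_mat m n"
  by (intro carrier_matI) auto

lemma mat_adjoint_mult:
  fixes A B :: "complex mat"
  assumes "A \<in> carrier_mat n m" "B \<in> carrier_mat m k"
  shows "mat_adjoint (A * B) = mat_adjoint B * mat_adjoint A"
  by (rule eq_matI) (use assms in \<open>auto simp: scalar_prod_def mult.commute\<close>)

lemma mat_adjoint_adjoint [simp]: "mat_adjoint (mat_adjoint A) = (A :: complex mat)"
  by (rule eq_matI) auto

lemma unitary_swap:
  fixes U :: "complex mat"
  assumes "U \<in> carrier_mat n n" "mat_adjoint U * U = 1\<^sub>m n"
  shows "U * mat_adjoint U = 1\<^sub>m n"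
  using mat_mult_left_right_inverse[of "mat_adjoint U" n U] assms by auto

text \<open>Gram-Schmidt leaves the first vector unchanged, so normalising its output makes the
  given vector a multiple of the first column of a unitary matrix.\<close>

lemma unitary_with_first_column:
  fixes v :: "complex vec"
  assumes v: "v \<in> carrier_vec n" "v \<noteq> 0\<^sub>v n"
  obtains W c where "W \<in> carrier_mat n n" "mat_adjoint W * W = 1\<^sub>m n" "col W 0 = c \<cdot>\<^sub>v v" 
proof -
  interpret cof_vec_space n "TYPE(complex)" .
  define b where "b = basis_completion v"
  define ws where "ws = gram_schmidt n b"
  have n: "n \<noteq> 0" using v by (metis carrier_vecD eq_vecI index_zero_vec(2) less_nat_zero_code)
  from basis_completion[OF v, folded b_def]
  have dist_b: "distinct b" and indep: "\<not> lin_dep (set b)" and b: "set b \<subseteq> carrier_vec n"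
    and hdb: "hd b = v" and len_b: "length b = n" by auto
  from hdb len_b n obtain vs where bv: "b = v # vs" by (cases b, auto)
  from gram_schmidt_result[OF b dist_b indep refl, folded ws_def]
  have ws: "set ws \<subseteq> carrier_vec n" "corthogonal ws" "length ws = n"
    by (auto simp: len_b)
  from gram_schmidt_hd[OF v(1), of vs, folded bv] have hdws: "hd ws = v" unfolding ws_def .
  have wsn: "ws ! i \<in> carrier_vec n" if "i < n" for i
    using ws that by auto
  define r where "r i = complex_of_real (1 / sqrt (Re (ws ! i \<bullet>c ws ! i)))" for i
  have rr: "cnj (r i) * r i * (ws ! i \<bullet>c ws ! i) = 1" if i: "i < n" for i
  proof -
    have nz: "ws ! i \<bullet>c ws ! i \<noteq> 0"
      using corthogonalD[OF ws(2), of i i] ws(3) i by auto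
    have "ws ! i \<bullet>c ws ! i \<ge> 0" by (rule conjugate_square_ge_0_vec)
    then have re: "ws ! i \<bullet>c ws ! i = complex_of_real (Re (ws ! i \<bullet>c ws ! i))"
      and pos: "Re (ws ! i \<bullet>c ws ! i) > 0"
      using nz by (auto simp: complex_eq_iff less_eq_complex_def)
    have "cnj (r i) * r i = complex_of_real (1 / Re (ws ! i \<bullet>c ws ! i))"
      using pos unfolding r_def
      by (simp add: real_sqrt_mult [symmetric] flip: of_real_mult of_real_divide)
    then show ?thesis using pos by (subst re) (simp flip: of_real_mult)
  qed
  define W where "W = Matrix.mat n n (\<lambda>(i,j). r j * ws ! j $ i)"
  have W: "W \<in> carrier_mat n n" by (simp add: W_def)
  have "mat_adjoint W * W = 1\<^sub>m n"
  proof (rule eq_matI, goal_cases)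
    case (1 i j)
    then have ij: "i < n" "j < n" by auto
    have "(mat_adjoint W * W) $$ (i,j) = (\<Sum>k<n. cnj (r i * ws ! i $ k) * (r j * ws ! j $ k))"
      using ij W by (simp add: scalar_prod_def W_def atLeast0LessThan)
    also have "\<dots> = cnj (r i) * r j * (ws ! j \<bullet>c ws ! i)"
      using wsn[OF ij(1)] wsn[OF ij(2)] unfolding scalar_prod_def
      by (auto simp: sum_distrib_left atLeast0LessThan mult_ac intro!: sum.cong)
    also have "\<dots> = (if i = j then 1 else 0)"
      using rr[OF ij(1)] corthogonalD[OF ws(2), of j i] ws(3) ij by auto
    finally show ?case using ij by simp
  qed (use W in auto)
  moreover have "ws ! 0 = v"
    using hdws ws(3) n by (metis hd_conv_nth list.size(3))
  then have "col W 0 = r 0 \<cdot>\<^sub>v v"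
    using n v by (intro eq_vecI) (auto simp: W_def)
  ultimately show ?thesis using that W by blast
qed

lemma complex_mat_eigenvector:
  fixes A :: "complex mat"
  assumes "A \<in> carrier_mat n n" "n \<noteq> 0"
  obtains v e where "v \<in> carrier_vec n" "v \<noteq> 0\<^sub>v n" "A *\<^sub>v v = e \<cdot>\<^sub>v v"
proof -
  obtain es where es: "char_poly A = (\<Prod>a\<leftarrow>es. [:- a, 1:])" "length es = n"
    using char_poly_factorized[OF assms(1)] by auto
  with \<open>n \<noteq> 0\<close> obtain e where "e \<in> set es" by (cases es) auto
  then have "poly (char_poly A) e = 0"
    unfolding es(1) poly_prod_list by (auto simp: prod_list_zero_iff)
  then have "eigenvalue A e" using eigenvalue_root_char_poly[OF assms(1)] by auto
  then show ?thesis using that assms(1) unfolding eigenvalue_def eigenvector_def by auto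
qed

text \<open>Induction on the size: a unit eigenvector as first basis vector splits off a \<open>1 \<times> 1\<close> block,
  because a Hermitian matrix with vanishing first column below the diagonal also has vanishing first
  row beyond it.\<close>

theorem hermitian_spectral_decomp:
  fixes A :: "complex mat"
  assumes "A \<in> carrier_mat n n" "mat_adjoint A = A"
  shows "\<exists>U d. spectral_decomp A U d"
  using assms
proof (induction n arbitrary: A)
  case 0
  have "A = 1\<^sub>m 0 * mat_diag 0 (\<lambda>i. complex_of_real 0) * mat_adjoint (1\<^sub>m 0)"
    by (rule eq_matI) (use 0 in auto)
  then show ?case
    using 0 by (intro exI[of _ "1\<^sub>m 0"] exI[of _ "\<lambda>_. 0"]) (auto simp: spectral_decomp_def Let_def)
next
  case (Suc n)
  note A = Suc.prems(1)
  obtain v e where v: "v \<in> carrier_vec (Suc n)" "v \<noteq> 0\<^sub>v (Suc n)" "A *\<^sub>v v = e \<cdot>\<^sub>v v"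
    using complex_mat_eigenvector[OF A] by auto
  obtain W c where W: "W \<in> carrier_mat (Suc n) (Suc n)" "mat_adjoint W * W = 1\<^sub>m (Suc n)"
      "col W 0 = c \<cdot>\<^sub>v v"
    using unitary_with_first_column[OF v(1,2)] by blast
  note W' = mat_adjoint_carrier[OF W(1)]
  note WW = unitary_swap[OF W(1,2)]
  define B where "B = mat_adjoint W * A * W"
  have B: "B \<in> carrier_mat (Suc n) (Suc n)" using A W W' by (auto simp: B_def)
  have Bh: "mat_adjoint B = B"
    unfolding B_def using A W W' Suc.prems(2)
    by (simp add: mat_adjoint_mult[of _ "Suc n" "Suc n" _ "Suc n"] assoc_mult_mat[of _ "Suc n" "Suc n" _ "Suc n" _ "Suc n"] mult_carrier_mat[of _ "Suc n" "Suc n" _ "Suc n"])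
  have AB: "A = W * B * mat_adjoint W"
  proof -
    have "W * B * mat_adjoint W = (W * mat_adjoint W) * A * (W * mat_adjoint W)"
      unfolding B_def using A W W' 
      by (simp add: assoc_mult_mat[of _ "Suc n" "Suc n" _ "Suc n" _ "Suc n"] mult_carrier_mat[of _ "Suc n" "Suc n" _ "Suc n"])
    then show ?thesis using WW A by simp
  qed
  have AW: "A *\<^sub>v col W 0 = e \<cdot>\<^sub>v col W 0"
    unfolding W(3) using v A
    by (metis mult_mat_vec smult_smult_assoc mult.commute)
  have B0: "B $$ (i, 0) = (if i = 0 then e else 0)" if i: "i < Suc n" for i
  proof -
    have "B $$ (i,0) = (mat_adjoint W * (A * W)) $$ (i,0)"
      unfolding B_def using A W W' by (simp add: assoc_mult_mat[of _ "Suc n" "Suc n" _ "Suc n" _ "Suc n"] mult_carrier_mat[of _ "Suc n" "Suc n" _ "Suc n"])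
    also have "\<dots> = row (mat_adjoint W) i \<bullet> col (A * W) 0"
      using A W i by (intro index_mult_mat(1)) auto
    also have "col (A * W) 0 = A *\<^sub>v col W 0"
      using A W by (intro col_mult2) auto
    also have "row (mat_adjoint W) i \<bullet> (A *\<^sub>v col W 0) = e * (row (mat_adjoint W) i \<bullet> col W 0)"
      unfolding AW using W(1) i by (intro scalar_prod_smult_right) auto
    also have "row (mat_adjoint W) i \<bullet> col W 0 = (mat_adjoint W * W) $$ (i,0)"
      using W(1) i by (intro index_mult_mat(1)[symmetric]) auto
    finally show ?thesis using i by (simp add: W(2))
  qed
  have B0': "B $$ (0, i) = (if i = 0 then e else 0)" if i: "i < Suc n" for i
  proof -
    have "B $$ (0,i) = cnj (B $$ (i,0))"
      using arg_cong[OF Bh, of "\<lambda>M. M $$ (0,i)"] B i by simp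
    then show ?thesis using B0[OF i] B0[of 0] arg_cong[OF Bh, of "\<lambda>M. M $$ (0,0)"] B by auto
  qed
  have ereal: "e = complex_of_real (Re e)"
    using B0[of 0] arg_cong[OF Bh, of "\<lambda>M. M $$ (0,0)"] B by (auto simp: complex_eq_iff)
  define A3 where "A3 = Matrix.mat n n (\<lambda>(i,j). B $$ (Suc i, Suc j))"
  have A3: "A3 \<in> carrier_mat n n" by (simp add: A3_def)
  have "mat_adjoint A3 = A3"
  proof (rule eq_matI, goal_cases)
    case (1 i j)
    then show ?case using A3 arg_cong[OF Bh, of "\<lambda>M. M $$ (Suc i, Suc j)"] B
      by (auto simp: A3_def)
  qed (use A3 in auto)
  from Suc.IH[OF A3 this] obtain U d where
    U: "U \<in> carrier_mat n n" "mat_adjoint U * U = 1\<^sub>m n"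
       "A3 = U * mat_diag n (\<lambda>i. complex_of_real (d i)) * mat_adjoint U"
    using A3 by (auto simp: spectral_decomp_def Let_def)
  note U' = mat_adjoint_carrier[OF U(1)]
  define V where "V = four_block_mat (1\<^sub>m 1) (0\<^sub>m 1 n) (0\<^sub>m n 1) U"
  define d' where "d' i = (case i of 0 \<Rightarrow> Re e | Suc i \<Rightarrow> d i)" for i
  have V: "V \<in> carrier_mat (Suc n) (Suc n)" using U by (auto simp: V_def)
  have Vadj: "mat_adjoint V = four_block_mat (1\<^sub>m 1) (0\<^sub>m 1 n) (0\<^sub>m n 1) (mat_adjoint U)"
    unfolding V_def by (rule eq_matI) (use U in \<open>auto simp: four_block_mat_def Let_def\<close>)
  note V' = mat_adjoint_carrier[OF V]
  have VV: "mat_adjoint V * V = 1\<^sub>m (Suc n)"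
    unfolding Vadj unfolding V_def
    using U U' by (subst mult_four_block_mat[of _ 1 1 _ n _ n _ _ 1 _ n]) (auto intro!: eq_matI simp: four_block_mat_def Let_def)
  have D: "mat_diag (Suc n) (\<lambda>i. complex_of_real (d' i)) =
      four_block_mat (mat_diag 1 (\<lambda>_. e)) (0\<^sub>m 1 n) (0\<^sub>m n 1) (mat_diag n (\<lambda>i. complex_of_real (d i)))"
    by (rule eq_matI) (use ereal in \<open>auto simp: four_block_mat_def Let_def mat_diag_def d'_def split: nat.splits\<close>)
  let ?D = "mat_diag n (\<lambda>i. complex_of_real (d i))" and ?e = "mat_diag 1 (\<lambda>_. e)"
  have cs: "?D \<in> carrier_mat n n" "?e \<in> carrier_mat 1 1" "U * ?D \<in> carrier_mat n n" using U by auto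
  have z: "1\<^sub>m 1 * ?e = ?e" "0\<^sub>m 1 n * ?D = 0\<^sub>m 1 n" "0\<^sub>m n 1 * ?e = 0\<^sub>m n 1"
      "?e * 1\<^sub>m 1 = ?e" "?e * 0\<^sub>m 1 n = 0\<^sub>m 1 n"
    using right_mult_one_mat[OF cs(2)] right_mult_zero_mat[OF cs(2)] left_mult_one_mat[OF cs(2)] left_mult_zero_mat[OF cs(1)] left_mult_zero_mat[OF cs(2)] by auto
  have "four_block_mat (1\<^sub>m 1) (0\<^sub>m 1 n) (0\<^sub>m n 1) U * four_block_mat ?e (0\<^sub>m 1 n) (0\<^sub>m n 1) ?D
      = four_block_mat ?e (0\<^sub>m 1 n) (0\<^sub>m n 1) (U * ?D)"
    using U cs by (subst mult_four_block_mat[of _ 1 1 _ n _ n _ _ 1 _ n])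
      (auto intro!: cong_four_block_mat simp: z simp del: One_nat_def)
  moreover have "four_block_mat ?e (0\<^sub>m 1 n) (0\<^sub>m n 1) (U * ?D) *
        four_block_mat (1\<^sub>m 1) (0\<^sub>m 1 n) (0\<^sub>m n 1) (mat_adjoint U)
      = four_block_mat ?e (0\<^sub>m 1 n) (0\<^sub>m n 1) A3"
    using U(1) U' cs by (subst mult_four_block_mat[of _ 1 1 _ n _ n _ _ 1 _ n])
      (auto intro!: cong_four_block_mat simp: z U(3)[symmetric] left_add_zero_mat[OF A3] simp del: One_nat_def)
  ultimately have "V * mat_diag (Suc n) (\<lambda>i. complex_of_real (d' i)) * mat_adjoint V
      = four_block_mat ?e (0\<^sub>m 1 n) (0\<^sub>m n 1) A3"
    unfolding Vadj D unfolding V_def by simp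
  also have "\<dots> = B"
    using B A3 by (intro eq_matI) (auto simp: four_block_mat_def Let_def mat_diag_def B0 B0' A3_def)
  finally have BV: "B = V * mat_diag (Suc n) (\<lambda>i. complex_of_real (d' i)) * mat_adjoint V" ..
  have Dc: "mat_diag (Suc n) (\<lambda>i. complex_of_real (d' i)) \<in> carrier_mat (Suc n) (Suc n)" by simp
  have adj: "mat_adjoint (W * V) = mat_adjoint V * mat_adjoint W"
    using W V by (simp add: mat_adjoint_mult)
  have "mat_adjoint (W * V) * (W * V) = mat_adjoint V * (mat_adjoint W * W) * V"
    unfolding adj using W(1) V W' V' by (simp add: assoc_mult_mat[of _ "Suc n" "Suc n" _ "Suc n" _ "Suc n"] mult_carrier_mat[of _ "Suc n" "Suc n" _ "Suc n"])
  then have u: "mat_adjoint (W * V) * (W * V) = 1\<^sub>m (Suc n)"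
    using W V V' VV by simp
  have "A = (W * V) * mat_diag (Suc n) (\<lambda>i. complex_of_real (d' i)) * mat_adjoint (W * V)"
    unfolding adj using AB W V W' V' Dc unfolding BV
    by (simp add: assoc_mult_mat[of _ "Suc n" "Suc n" _ "Suc n" _ "Suc n"] mult_carrier_mat[of _ "Suc n" "Suc n" _ "Suc n"])
  then have "spectral_decomp A (W * V) d'"
    using A W V u unitary_swap[OF _ u] by (auto simp: spectral_decomp_def Let_def)
  then show ?case by blast
qed

definition diag_conj :: "complex mat \<Rightarrow> (nat \<Rightarrow> complex) \<Rightarrow> complex mat" where
  "diag_conj U g = U * mat_diag (dim_row U) g * mat_adjoint U"

lemma diag_conj_carrier [simp, intro]: "U \<in> carrier_mat n n \<Longrightarrow> diag_conj U g \<in> carrier_mat n n"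
  by (auto simp: diag_conj_def)

lemma diag_conj_index:
  assumes "U \<in> carrier_mat n n" "i < n" "j < n"
  shows "diag_conj U g $$ (i,j) = (\<Sum>l<n. U $$ (i,l) * g l * cnj (U $$ (j,l)))"
  using assms unfolding diag_conj_def
  by (subst mat_diag_mult_right[of _ n]) (auto simp: scalar_prod_def atLeast0LessThan)

lemma spectral_decompD:
  assumes "spectral_decomp A U d" "A \<in> carrier_mat n n"
  shows "U \<in> carrier_mat n n" "mat_adjoint U * U = 1\<^sub>m n" "U * mat_adjoint U = 1\<^sub>m n"
    "A = diag_conj U (\<lambda>i. complex_of_real (d i))"
  using assms by (auto simp: spectral_decomp_def Let_def diag_conj_def)

lemma spectral_decompI:
  assumes "U \<in> carrier_mat n n" "mat_adjoint U * U = 1\<^sub>m n"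
    "A = diag_conj U (\<lambda>i. complex_of_real (d i))"
  shows "spectral_decomp A U d"
  using assms(1,2) unitary_swap[OF assms(1,2)] unfolding assms(3)
  by (auto simp: spectral_decomp_def Let_def diag_conj_def)

lemma diag_conj_mult:
  assumes "U \<in> carrier_mat n n" "mat_adjoint U * U = 1\<^sub>m n"
  shows "diag_conj U f * diag_conj U g = diag_conj U (\<lambda>i. f i * g i)"
proof -
  let ?F = "mat_diag n f" and ?G = "mat_diag n g"
  note U' = mat_adjoint_carrier[OF assms(1)]
  have F: "?F \<in> carrier_mat n n" "?G \<in> carrier_mat n n" by auto
  have "diag_conj U f * diag_conj U g = U * ?F * (mat_adjoint U * U) * ?G * mat_adjoint U"
    using assms(1) U' F unfolding diag_conj_def by (simp add: assoc_mult_mat[of _ n n _ n _ n] mult_carrier_mat[of _ n n _ n])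
  also have "\<dots> = U * (?F * ?G) * mat_adjoint U"
    using assms U' F by (simp add: left_mult_one_mat[of _ n n] assoc_mult_mat[of _ n n _ n _ n] mult_carrier_mat[of _ n n _ n] del: mat_diag_diag)
  finally show ?thesis using assms(1) by (simp add: diag_conj_def)
qed

lemma diag_conj_trace:
  assumes U: "U \<in> carrier_mat n n" "mat_adjoint U * U = 1\<^sub>m n"
  shows "mat_trace (diag_conj U g) = (\<Sum>l<n. g l)"
proof -
  have "mat_trace (diag_conj U g) = (\<Sum>i<n. \<Sum>l<n. U $$ (i,l) * g l * cnj (U $$ (i,l)))"
    using U(1) diag_conj_carrier[OF U(1), of g] by (simp add: mat_trace_def diag_conj_index del: diag_conj_carrier)
  also have "\<dots> = (\<Sum>l<n. g l * (\<Sum>i<n. cnj (U $$ (i,l)) * U $$ (i,l)))"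
    by (subst sum.swap) (simp add: sum_distrib_left mult_ac)
  also have "\<dots> = (\<Sum>l<n. g l * (mat_adjoint U * U) $$ (l,l))"
    using U(1) by (auto intro!: sum.cong simp: scalar_prod_def atLeast0LessThan)
  finally show ?thesis using U by simp
qed

text \<open>Two diagonalisations \<open>U D U\<^sup>* = V E V\<^sup>*\<close> are intertwined by \<open>X = U\<^sup>* V\<close>: \<open>d\<^sub>i X\<^sub>i\<^sub>j = X\<^sub>i\<^sub>j e\<^sub>j\<close>.
  So \<open>X\<^sub>i\<^sub>j \<noteq> 0\<close> forces \<open>d\<^sub>i = e\<^sub>j\<close>, and \<open>X\<close> intertwines \<open>f(D)\<close> and \<open>f(E)\<close> as well.\<close>

lemma diag_conj_unique:
  assumes U: "U \<in> carrier_mat n n" "mat_adjoint U * U = 1\<^sub>m n"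
      and V: "V \<in> carrier_mat n n" "mat_adjoint V * V = 1\<^sub>m n"
      and eq: "diag_conj U d = diag_conj V e"
      and f: "\<And>i j. i < n \<Longrightarrow> j < n \<Longrightarrow> d i = e j \<Longrightarrow> f i = g j"
  shows "diag_conj U f = diag_conj V g"
proof -
  note U' = mat_adjoint_carrier[OF U(1)] and V' = mat_adjoint_carrier[OF V(1)]
  note assoc = assoc_mult_mat[of _ n n _ n _ n]
  note [simp] = mult_carrier_mat[of _ n n _ n]
  have D: "mat_diag n h \<in> carrier_mat n n" for h :: "nat \<Rightarrow> complex" by simp
  define X where "X = mat_adjoint U * V"
  have X: "X \<in> carrier_mat n n" using U' V by (auto simp: X_def)
  have "mat_adjoint U * diag_conj U d * V = (mat_adjoint U * U) * mat_diag n d * X"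
    using U(1) V(1) U' V' D unfolding diag_conj_def X_def by (simp add: assoc)
  then have 1: "mat_adjoint U * diag_conj U d * V = mat_diag n d * X"
    using U(2) D X by (simp add: left_mult_one_mat[of _ n n])
  have "mat_adjoint U * diag_conj V e * V = X * mat_diag n e * (mat_adjoint V * V)"
    using U(1) V(1) U' V' D unfolding diag_conj_def X_def by (simp add: assoc)
  then have 2: "mat_adjoint U * diag_conj V e * V = X * mat_diag n e"
    using V(2) mult_carrier_mat[OF X D, of e] by (simp add: right_mult_one_mat[of _ n n])
  have comm: "mat_diag n d * X = X * mat_diag n e"
    using 1 2 eq by simp
  have ij: "d i * X $$ (i,j) = X $$ (i,j) * e j" if "i < n" "j < n" for i j
    using arg_cong[OF comm, of "\<lambda>M. M $$ (i,j)"] X that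
    by (simp add: mat_diag_mult_left[OF X] mat_diag_mult_right[OF X])
  have FX: "mat_diag n f * X = X * mat_diag n g"
  proof (rule eq_matI, goal_cases)
    case (1 i j)
    then have "i < n" "j < n" using X carrier_matD[OF D[of g]] by auto
    then show ?case using ij[of i j] f[of i j] X
      by (auto simp: mat_diag_mult_left[OF X] mat_diag_mult_right[OF X])
  qed (use X carrier_matD[OF D[of g]] carrier_matD[OF D[of f]] in auto)
  have UX: "U * X = V" 
    unfolding X_def using U(1) U' V(1) unitary_swap[OF U] by (simp add: assoc[symmetric])
  have XV: "X * mat_adjoint V = mat_adjoint U"
    unfolding X_def using V(1) V' U' unitary_swap[OF V] by (simp add: assoc right_mult_one_mat[of _ n n])
  have "diag_conj U f = U * mat_diag n f * (X * mat_adjoint V)"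
    using U(1) by (simp add: diag_conj_def XV)
  also have "\<dots> = U * (mat_diag n f * X) * mat_adjoint V"
    using U(1) V' X D by (simp add: assoc)
  also have "\<dots> = (U * X) * mat_diag n g * mat_adjoint V"
    unfolding FX using U(1) V' X D by (simp add: assoc)
  finally show ?thesis using V(1) by (simp add: UX diag_conj_def)
qed

lemma mat_fun_eq:
  assumes A: "A \<in> carrier_mat n n" and d: "spectral_decomp A U d"
  shows "mat_fun f A = diag_conj U (\<lambda>i. complex_of_real (f (d i)))"
proof -
  have "\<exists>V e. spectral_decomp A V e \<and> mat_fun f A =
          V * mat_diag (dim_row A) (\<lambda>i. complex_of_real (f (e i))) * mat_adjoint V"
    unfolding mat_fun_def by (rule someI_ex) (use d in blast)
  then obtain V e where V: "spectral_decomp A V e"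
    "mat_fun f A = V * mat_diag (dim_row A) (\<lambda>i. complex_of_real (f (e i))) * mat_adjoint V"
    by blast
  note UD = spectral_decompD[OF d A] and VD = spectral_decompD[OF V(1) A]
  have "mat_fun f A = diag_conj V (\<lambda>i. complex_of_real (f (e i)))"
    using V(2) VD(1) A by (simp add: diag_conj_def)
  also have "\<dots> = diag_conj U (\<lambda>i. complex_of_real (f (d i)))"
    by (rule diag_conj_unique[OF VD(1,2) UD(1,2)]) (use UD(4) VD(4) in auto)
  finally show ?thesis .
qed

lemma diag_conj_power:
  assumes U: "U \<in> carrier_mat n n" "mat_adjoint U * U = 1\<^sub>m n"
  shows "diag_conj U g ^\<^sub>m k = diag_conj U (\<lambda>i. g i ^ k)"
proof (induction k)
  case 0
  have "mat_diag n (\<lambda>i. 1) = (1\<^sub>m n :: complex mat)" by (rule eq_matI) (auto simp: mat_diag_def)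
  then show ?case
    using U unitary_swap[OF U] carrier_matD[OF diag_conj_carrier[OF U(1), of g]]
    by (simp add: diag_conj_def)
next
  case (Suc k)
  then show ?case using diag_conj_mult[OF U] by (simp add: mult.commute)
qed

lemma mat_exp_diag_conj:
  assumes U: "U \<in> carrier_mat n n" "mat_adjoint U * U = 1\<^sub>m n"
  shows "mat_exp (diag_conj U g) = diag_conj U (\<lambda>i. exp (g i))"
proof (rule eq_matI, goal_cases)
  case (1 i j)
  then have ij: "i < n" "j < n" using U by (auto simp: diag_conj_def)
  have "(\<lambda>k. \<Sum>l<n. U $$ (i,l) * cnj (U $$ (j,l)) * (g l ^ k /\<^sub>R fact k)) sums
        (\<Sum>l<n. U $$ (i,l) * cnj (U $$ (j,l)) * exp (g l))"
    by (intro sums_sum sums_mult exp_converges)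
  then have "(\<Sum>k. \<Sum>l<n. U $$ (i,l) * cnj (U $$ (j,l)) * (g l ^ k /\<^sub>R fact k)) =
        (\<Sum>l<n. U $$ (i,l) * cnj (U $$ (j,l)) * exp (g l))"
    by (rule sums_unique[symmetric])
  moreover have "(diag_conj U g ^\<^sub>m k) $$ (i,j) / fact k =
      (\<Sum>l<n. U $$ (i,l) * cnj (U $$ (j,l)) * (g l ^ k /\<^sub>R fact k))" for k
    using ij U by (simp add: diag_conj_power[OF U] diag_conj_index scaleR_conv_of_real
        sum_divide_distrib field_simps)
  ultimately show ?case
    using ij U carrier_matD[OF diag_conj_carrier[OF U(1), of g]]
    by (simp add: mat_exp_def diag_conj_index mult_ac)
qed (use U in \<open>auto simp: mat_exp_def diag_conj_def\<close>)

lemma smult_diag_conj: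
  assumes "U \<in> carrier_mat n n"
  shows "c \<cdot>\<^sub>m diag_conj U g = diag_conj U (\<lambda>i. c * g i)"
proof (rule eq_matI, goal_cases)
  case (1 i j)
  then have ij: "i < n" "j < n" using assms by (auto simp: diag_conj_def)
  then show ?case using assms carrier_matD[OF diag_conj_carrier[OF assms, of g]]
    by (simp add: diag_conj_index sum_distrib_left mult_ac)
qed (use assms in \<open>auto simp: diag_conj_def\<close>)

lemma gibbs_entropy_eq:
  fixes d :: "nat \<Rightarrow> real" and \<tau> :: real
  assumes A: "A \<in> carrier_mat n n" and d: "spectral_decomp A U d" and n: "n > 0"
  defines "Z \<equiv> \<Sum>i<n. exp (- \<tau> * d i)"
  shows "von_neumann_entropy (gibbs_state \<tau> A) = ln Z + \<tau> * (\<Sum>i<n. d i * exp (- \<tau> * d i)) / Z"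
proof -
  note U = spectral_decompD[OF d A]
  have Z: "Z > 0" unfolding Z_def by (rule sum_pos) (use n in auto)
  define q where "q i = exp (- \<tau> * d i) / Z" for i
  have K: "mat_exp (complex_of_real (- \<tau>) \<cdot>\<^sub>m A) = diag_conj U (\<lambda>i. complex_of_real (exp (- \<tau> * d i)))"
    unfolding U(4) smult_diag_conj[OF U(1)] mat_exp_diag_conj[OF U(1,2)]
    by (simp add: exp_of_real flip: of_real_mult of_real_minus)
  have "gibbs_state \<tau> A = diag_conj U (\<lambda>i. complex_of_real (q i))"
    unfolding gibbs_state_def Let_def K diag_conj_trace[OF U(1,2)] smult_diag_conj[OF U(1)]
    by (simp add: q_def Z_def flip: of_real_mult of_real_sum of_real_divide)
  moreover from this have "spectral_decomp (gibbs_state \<tau> A) U q"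
    by (rule spectral_decompI[OF U(1,2)])
  ultimately have "mat_log (gibbs_state \<tau> A) = diag_conj U (\<lambda>i. complex_of_real (ln (q i)))"
    unfolding mat_log_def using U(1) by (intro mat_fun_eq) auto
  then have "von_neumann_entropy (gibbs_state \<tau> A) = - Re (\<Sum>i<n. complex_of_real (q i * ln (q i)))"
    unfolding von_neumann_entropy_def using \<open>gibbs_state \<tau> A = _\<close>
    by (simp add: diag_conj_mult[OF U(1,2)] diag_conj_trace[OF U(1,2)])
  also have "\<dots> = - (\<Sum>i<n. q i * ln (q i))" by simp
  also have "\<dots> = (\<Sum>i<n. ln Z * exp (- \<tau> * d i) / Z + \<tau> * (d i * exp (- \<tau> * d i)) / Z)"
    unfolding sum_negf[symmetric] using Z
    by (intro sum.cong) (auto simp: q_def ln_div field_simps)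
  also have "\<dots> = ln Z * Z / Z + \<tau> * (\<Sum>i<n. d i * exp (- \<tau> * d i)) / Z"
    by (simp add: sum.distrib Z_def sum_distrib_left sum_divide_distrib)
  finally show ?thesis using Z by simp
qed

section \<open>Bounding a bilinear form by its discrepancy\<close>

lemma binary_digits_nat:
  fixes x :: nat
  assumes "x < 2 ^ N"
  shows "real x = (\<Sum>i<N. 2 ^ i * of_bool (bit x i))"
proof -
  have "x = take_bit N x" using assms by (simp add: take_bit_nat_eq_self)
  also have "\<dots> = (\<Sum>i<N. 2 ^ i * of_bool (bit x i))"
    by (simp add: take_bit_sum push_bit_eq_mult atLeast0LessThan mult.commute)
  finally have "real x = real (\<Sum>i<N. 2 ^ i * of_bool (bit x i))" by presburger
  then show ?thesis by (simp only: of_nat_sum of_nat_mult of_nat_power of_nat_numeral of_nat_of_bool)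
qed

lemma sum_squares_le_square_sum:
  fixes f :: "'a \<Rightarrow> real"
  assumes "finite I" "\<And>i. i \<in> I \<Longrightarrow> f i \<ge> 0"
  shows "(\<Sum>i\<in>I. (f i)\<^sup>2) \<le> (\<Sum>i\<in>I. f i)\<^sup>2"
  using assms
proof (induction I rule: finite_induct)
  case (insert i I)
  have "0 \<le> 2 * (f i * sum f I)" using insert by (intro mult_nonneg_nonneg sum_nonneg) auto
  then show ?case using insert by (simp add: power2_sum)
qed simp

locale discrepancy_bounded =
  fixes V :: "'a set" and M :: "'a \<Rightarrow> 'a \<Rightarrow> real" and \<alpha> \<Delta> :: real
  assumes finite_V [simp, intro]: "finite V"
    and row_sum: "u \<in> V \<Longrightarrow> (\<Sum>v\<in>V. \<bar>M u v\<bar>) \<le> \<Delta>"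
    and symm: "u \<in> V \<Longrightarrow> v \<in> V \<Longrightarrow> M u v = M v u"
    and disc: "S \<subseteq> V \<Longrightarrow> T \<subseteq> V \<Longrightarrow> \<bar>\<Sum>u\<in>S. \<Sum>v\<in>T. M u v\<bar> \<le> \<alpha> * sqrt (card S * card T)"
    and \<alpha>_nonneg: "\<alpha> \<ge> 0" and \<Delta>_nonneg: "\<Delta> \<ge> 0"
begin

lemma block_le_left:
  assumes "S \<subseteq> V" "T \<subseteq> V"
  shows "\<bar>\<Sum>u\<in>S. \<Sum>v\<in>T. M u v\<bar> \<le> \<Delta> * card S"
proof -
  have "\<bar>\<Sum>u\<in>S. \<Sum>v\<in>T. M u v\<bar> \<le> (\<Sum>u\<in>S. \<Sum>v\<in>T. \<bar>M u v\<bar>)"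
    by (rule order.trans[OF sum_abs]) (intro sum_mono sum_abs)
  also have "\<dots> \<le> (\<Sum>u\<in>S. \<Sum>v\<in>V. \<bar>M u v\<bar>)"
    using assms by (intro sum_mono sum_mono2) auto
  also have "\<dots> \<le> (\<Sum>u\<in>S. \<Delta>)" using assms by (intro sum_mono row_sum) auto
  finally show ?thesis by (simp add: mult.commute)
qed

lemma block_le_right:
  assumes "S \<subseteq> V" "T \<subseteq> V"
  shows "\<bar>\<Sum>u\<in>S. \<Sum>v\<in>T. M u v\<bar> \<le> \<Delta> * card T"
proof -
  have "(\<Sum>u\<in>S. \<Sum>v\<in>T. M u v) = (\<Sum>v\<in>T. \<Sum>u\<in>S. M v u)"
    using assms by (subst sum.swap) (intro sum.cong symm, auto)
  then show ?thesis using block_le_left[OF assms(2,1)] by simp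
qed

definition gap_constant :: "nat \<Rightarrow> real" where
  "gap_constant \<gamma> = \<alpha> * (2 * real \<gamma> + 1) / 2 + \<Delta> / 2 ^ \<gamma>"

text \<open>Share of the \<open>(i, j)\<close> block that is charged to the level \<open>i\<close>.  Blocks of comparable levels
  are bounded by the discrepancy, and split evenly by the AM-GM inequality; blocks of distant levels
  are bounded by the row sums, and charged to the larger level.\<close>

definition charge :: "nat \<Rightarrow> nat \<Rightarrow> nat \<Rightarrow> real" where
  "charge \<gamma> i j = (if i \<le> j + \<gamma> \<and> j \<le> i + \<gamma> then \<alpha> / 2 else if j < i then \<Delta> * (2 ^ j / 2 ^ i) else 0)"

lemma sum_charge_le: "(\<Sum>j<N. charge \<gamma> i j) \<le> gap_constant \<gamma>"
proof -
  have "(\<Sum>j<N. charge \<gamma> i j) \<le> (\<Sum>j<N. (if j \<in> {i - \<gamma>..i + \<gamma>} then \<alpha> / 2 else 0)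
      + (if j \<in> {..<i - \<gamma>} then \<Delta> * (2 ^ j / 2 ^ i) else 0))"
    using \<alpha>_nonneg \<Delta>_nonneg by (intro sum_mono) (auto simp: charge_def)
  also have "\<dots> = (\<Sum>j\<in>{..<N} \<inter> {i - \<gamma>..i + \<gamma>}. \<alpha> / 2) + (\<Sum>j\<in>{..<N} \<inter> {..<i - \<gamma>}. \<Delta> * (2 ^ j / 2 ^ i))"
    by (simp only: sum.distrib sum.inter_restrict[symmetric] finite_lessThan)
  also have "\<dots> \<le> (\<Sum>j\<in>{i - \<gamma>..i + \<gamma>}. \<alpha> / 2) + (\<Sum>j<i - \<gamma>. \<Delta> * (2 ^ j / 2 ^ i))"
    using \<alpha>_nonneg \<Delta>_nonneg by (intro add_mono sum_mono2) auto
  also have "(\<Sum>j\<in>{i - \<gamma>..i + \<gamma>}. \<alpha> / 2) \<le> \<alpha> * (2 * real \<gamma> + 1) / 2"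
  proof -
    have "card {i - \<gamma>..i + \<gamma>} \<le> 2 * \<gamma> + 1" unfolding card_atLeastAtMost by linarith
    then have "real (card {i - \<gamma>..i + \<gamma>}) \<le> 2 * real \<gamma> + 1" by linarith
    then have "real (card {i - \<gamma>..i + \<gamma>}) * (\<alpha> / 2) \<le> (2 * real \<gamma> + 1) * (\<alpha> / 2)"
      using \<alpha>_nonneg by (intro mult_right_mono) auto
    then show ?thesis by (simp only: sum_constant mult_ac times_divide_eq_right)
  qed
  also have "(\<Sum>j<i - \<gamma>. \<Delta> * (2 ^ j / 2 ^ i)) \<le> \<Delta> / 2 ^ \<gamma>"
  proof (cases "\<gamma> \<le> i")
    case True
    have "(\<Sum>j<i - \<gamma>. \<Delta> * (2 ^ j / 2 ^ i)) = \<Delta> / 2 ^ i * (\<Sum>j<i - \<gamma>. 2 ^ j)"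
      by (simp add: sum_distrib_left)
    also have "(\<Sum>j<i - \<gamma>. 2 ^ j) = (2 :: real) ^ (i - \<gamma>) - 1"
      by (induction "i - \<gamma>") (auto simp: sum_gp0 geometric_sum)
    also have "\<Delta> / 2 ^ i * (2 ^ (i - \<gamma>) - 1) \<le> \<Delta> / 2 ^ i * 2 ^ (i - \<gamma>)"
      using \<Delta>_nonneg by (intro mult_left_mono) auto
    also have "\<dots> = \<Delta> / 2 ^ \<gamma>" using True by (simp add: power_diff)
    finally show ?thesis .
  qed (use \<Delta>_nonneg in auto)
  finally show ?thesis by (simp add: gap_constant_def)
qed

lemma block_le_charge:
  assumes "S \<subseteq> V" "T \<subseteq> V"
  shows "2 ^ i * 2 ^ j * \<bar>\<Sum>u\<in>S. \<Sum>v\<in>T. M u v\<bar> \<le> charge \<gamma> i j * (4 ^ i * real (card S)) + charge \<gamma> j i * (4 ^ j * real (card T))"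
proof -
  let ?b = "\<bar>\<Sum>u\<in>S. \<Sum>v\<in>T. M u v\<bar>"
  have four: "(4 :: real) ^ k = 2 ^ k * 2 ^ k" for k by (simp flip: power_mult_distrib)
  consider "i \<le> j + \<gamma> \<and> j \<le> i + \<gamma>" | "j + \<gamma> < i" | "i + \<gamma> < j" by linarith
  then show ?thesis
  proof cases
    case 1
    have "2 ^ i * 2 ^ j * ?b \<le> 2 ^ i * 2 ^ j * (\<alpha> * sqrt (card S * card T))"
      using disc[OF assms] by (intro mult_left_mono) auto
    also have "\<dots> = \<alpha> * sqrt ((4 ^ i * real (card S)) * (4 ^ j * real (card T)))"
      by (simp add: four real_sqrt_mult)
    also have "\<dots> \<le> \<alpha> * ((4 ^ i * real (card S) + 4 ^ j * real (card T)) / 2)"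
      by (rule mult_left_mono[OF arith_geo_mean_sqrt]) (use \<alpha>_nonneg in auto)
    finally show ?thesis using 1 by (simp add: charge_def algebra_simps add_divide_distrib)
  next
    case 2
    have "2 ^ i * 2 ^ j * ?b \<le> 2 ^ i * 2 ^ j * (\<Delta> * card S)"
      using block_le_left[OF assms] by (intro mult_left_mono) auto
    then show ?thesis using 2 by (simp add: charge_def four mult_ac)
  next
    case 3
    have "2 ^ i * 2 ^ j * ?b \<le> 2 ^ i * 2 ^ j * (\<Delta> * card T)"
      using block_le_right[OF assms] by (intro mult_left_mono) auto
    then show ?thesis using 3 by (simp add: charge_def four mult_ac)
  qed
qed

text \<open>Binary digits write \<open>x\<close> as \<open>\<Sum>i. 2\<^sup>i 1\<^bsub>B i\<^esub>\<close> exactly, which reduces the form to rectangles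
  without rounding. The masses satisfy \<open>(\<Sum>i. 4\<^sup>i |B i|) \<le> \<parallel>x\<parallel>\<^sup>2\<close>, since a sum of squares of
  nonnegative numbers is at most the square of the sum.\<close>

lemma bilinear_nat_le:
  fixes x y :: "'a \<Rightarrow> nat"
  shows "\<bar>\<Sum>u\<in>V. \<Sum>v\<in>V. M u v * x u * y v\<bar> \<le> gap_constant \<gamma> * ((\<Sum>u\<in>V. (real (x u))\<^sup>2) + (\<Sum>u\<in>V. (real (y u))\<^sup>2))"
proof -
  obtain N where N: "x u < 2 ^ N" "y u < 2 ^ N" if "u \<in> V" for u
  proof
    let ?N = "Max (x ` V \<union> y ` V)"
    fix u assume u: "u \<in> V"
    have "x u \<le> ?N" "y u \<le> ?N" using u by (auto intro!: Max_ge)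
    moreover have "?N < 2 ^ ?N" by (rule less_exp)
    ultimately show "x u < 2 ^ ?N" "y u < 2 ^ ?N" by linarith+
  qed
  define lev where "lev z i = {u \<in> V. bit (z u) i}" for z :: "'a \<Rightarrow> nat" and i
  have lev_sub: "lev z i \<subseteq> V" for z i by (auto simp: lev_def)
  have lev_sum: "(\<Sum>u\<in>V. of_bool (bit (z u) i) * f u) = (\<Sum>u\<in>lev z i. f u)" for z i and f :: "'a \<Rightarrow> real"
    unfolding lev_def by (simp add: sum.inter_filter of_bool_def if_distrib[of "\<lambda>t. t * _"] cong: if_cong)
  have mass: "(\<Sum>i<N. 4 ^ i * real (card (lev z i))) \<le> (\<Sum>u\<in>V. (real (z u))\<^sup>2)"
    if z: "\<And>u. u \<in> V \<Longrightarrow> z u < 2 ^ N" for z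
  proof -
    have "(\<Sum>i<N. 4 ^ i * real (card (lev z i))) = (\<Sum>i<N. \<Sum>u\<in>V. of_bool (bit (z u) i) * 4 ^ i)"
      by (simp add: lev_sum mult.commute)
    also have "\<dots> = (\<Sum>u\<in>V. \<Sum>i<N. (2 ^ i * of_bool (bit (z u) i))\<^sup>2)"
      by (subst sum.swap) (intro sum.cong refl, auto simp: power2_eq_square of_bool_def simp flip: power_mult_distrib)
    also have "\<dots> \<le> (\<Sum>u\<in>V. (\<Sum>i<N. 2 ^ i * of_bool (bit (z u) i))\<^sup>2)"
      by (intro sum_mono sum_squares_le_square_sum) auto
    also have "\<dots> = (\<Sum>u\<in>V. (real (z u))\<^sup>2)"
      using binary_digits_nat[OF z] by (intro sum.cong) auto
    finally show ?thesis .
  qed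
  have "(\<Sum>u\<in>V. \<Sum>v\<in>V. M u v * x u * y v) =
      (\<Sum>u\<in>V. \<Sum>v\<in>V. M u v * (\<Sum>i<N. 2 ^ i * of_bool (bit (x u) i)) * (\<Sum>j<N. 2 ^ j * of_bool (bit (y v) j)))"
    using binary_digits_nat[OF N(1)] binary_digits_nat[OF N(2)] by (intro sum.cong) auto
  also have "\<dots> = (\<Sum>u\<in>V. \<Sum>v\<in>V. \<Sum>i<N. \<Sum>j<N. of_bool (bit (x u) i) * (of_bool (bit (y v) j) * (2 ^ i * 2 ^ j * M u v)))"
    by (simp only: sum_distrib_left sum_distrib_right mult_ac)
  also have "\<dots> = (\<Sum>u\<in>V. \<Sum>i<N. \<Sum>v\<in>V. \<Sum>j<N. of_bool (bit (x u) i) * (of_bool (bit (y v) j) * (2 ^ i * 2 ^ j * M u v)))"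
    by (intro sum.cong refl sum.swap)
  also have "\<dots> = (\<Sum>i<N. \<Sum>u\<in>V. \<Sum>j<N. \<Sum>v\<in>V. of_bool (bit (x u) i) * (of_bool (bit (y v) j) * (2 ^ i * 2 ^ j * M u v)))"
    by (subst sum.swap) (intro sum.cong refl sum.swap)
  also have "\<dots> = (\<Sum>i<N. \<Sum>j<N. \<Sum>u\<in>V. \<Sum>v\<in>V. of_bool (bit (x u) i) * (of_bool (bit (y v) j) * (2 ^ i * 2 ^ j * M u v)))"
    by (intro sum.cong refl sum.swap)
  also have "\<dots> = (\<Sum>i<N. \<Sum>j<N. 2 ^ i * 2 ^ j * (\<Sum>u\<in>lev x i. \<Sum>v\<in>lev y j. M u v))"
    by (simp add: sum_distrib_left[symmetric] lev_sum)
  finally have "\<bar>\<Sum>u\<in>V. \<Sum>v\<in>V. M u v * x u * y v\<bar> \<le>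
      (\<Sum>i<N. \<Sum>j<N. 2 ^ i * 2 ^ j * \<bar>\<Sum>u\<in>lev x i. \<Sum>v\<in>lev y j. M u v\<bar>)"
    by (simp only:) (intro order.trans[OF sum_abs] sum_mono, simp add: abs_mult)
  also have "\<dots> \<le> (\<Sum>i<N. \<Sum>j<N. charge \<gamma> i j * (4 ^ i * real (card (lev x i))) + charge \<gamma> j i * (4 ^ j * real (card (lev y j))))"
    by (intro sum_mono block_le_charge lev_sub)
  also have "\<dots> = (\<Sum>i<N. (\<Sum>j<N. charge \<gamma> i j) * (4 ^ i * real (card (lev x i)))) +
                  (\<Sum>j<N. (\<Sum>i<N. charge \<gamma> j i) * (4 ^ j * real (card (lev y j))))"
    unfolding sum.distrib sum_distrib_right by (intro arg_cong2[of _ _ _ _ "(+)"] refl sum.swap)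
  also have "\<dots> \<le> (\<Sum>i<N. gap_constant \<gamma> * (4 ^ i * real (card (lev x i)))) + (\<Sum>j<N. gap_constant \<gamma> * (4 ^ j * real (card (lev y j))))"
    by (intro add_mono sum_mono mult_right_mono sum_charge_le) auto
  also have "\<dots> = gap_constant \<gamma> * ((\<Sum>i<N. 4 ^ i * real (card (lev x i))) + (\<Sum>j<N. 4 ^ j * real (card (lev y j))))"
    by (simp add: sum_distrib_left distrib_left)
  also have "\<dots> \<le> gap_constant \<gamma> * ((\<Sum>u\<in>V. (real (x u))\<^sup>2) + (\<Sum>u\<in>V. (real (y u))\<^sup>2))"
    using \<alpha>_nonneg \<Delta>_nonneg by (intro mult_left_mono add_mono mass N) (auto simp: gap_constant_def)
  finally show ?thesis .
qed

text \<open>Both sides are homogeneous of degree two and continuous, so dyadic rational vectors suffice.\<close>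

lemma bilinear_nonneg_le:
  fixes x y :: "'a \<Rightarrow> real"
  assumes "\<And>u. u \<in> V \<Longrightarrow> x u \<ge> 0" "\<And>u. u \<in> V \<Longrightarrow> y u \<ge> 0"
  shows "\<bar>\<Sum>u\<in>V. \<Sum>v\<in>V. M u v * x u * y v\<bar> \<le> gap_constant \<gamma> * ((\<Sum>u\<in>V. (x u)\<^sup>2) + (\<Sum>u\<in>V. (y u)\<^sup>2))"
proof -
  define app where "app z k = real (nat \<lfloor>2 ^ k * z\<rfloor>) / 2 ^ k" for z :: real and k :: nat
  have app_lim: "(\<lambda>k. app z k) \<longlonglongrightarrow> z" if z: "z \<ge> 0" for z
  proof (rule tendsto_sandwich)
    have e: "app z k = of_int \<lfloor>2 ^ k * z\<rfloor> / 2 ^ k" for k using z by (simp add: app_def)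
    have "z - 1 / 2 ^ k \<le> app z k" for k
    proof -
      have "2 ^ k * z - 1 \<le> of_int \<lfloor>2 ^ k * z\<rfloor>" by linarith
      from divide_right_mono[OF this, of "2 ^ k"] show ?thesis by (simp add: e diff_divide_distrib)
    qed
    then show "\<forall>\<^sub>F k in sequentially. z - 1 / 2 ^ k \<le> app z k" by simp
    have "app z k \<le> z" for k
    proof -
      have "of_int \<lfloor>2 ^ k * z\<rfloor> \<le> 2 ^ k * z" by linarith
      from divide_right_mono[OF this, of "2 ^ k"] show ?thesis by (simp add: e)
    qed
    then show "\<forall>\<^sub>F k in sequentially. app z k \<le> z" by simp
    show "(\<lambda>k. z - 1 / 2 ^ k) \<longlonglongrightarrow> z" by real_asymp
  qed auto
  have le: "\<bar>\<Sum>u\<in>V. \<Sum>v\<in>V. M u v * app (x u) k * app (y v) k\<bar> \<le>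
     gap_constant \<gamma> * ((\<Sum>u\<in>V. (app (x u) k)\<^sup>2) + (\<Sum>u\<in>V. (app (y u) k)\<^sup>2))" for k
  proof -
    let ?X = "\<lambda>u. nat \<lfloor>2 ^ k * x u\<rfloor>" and ?Y = "\<lambda>u. nat \<lfloor>2 ^ k * y u\<rfloor>"
    have "(\<Sum>u\<in>V. \<Sum>v\<in>V. M u v * app (x u) k * app (y v) k) = (\<Sum>u\<in>V. \<Sum>v\<in>V. M u v * ?X u * ?Y v) / 4 ^ k"
      by (simp add: app_def sum_divide_distrib flip: power_mult_distrib)
    moreover have "(\<Sum>u\<in>V. (app (z u) k)\<^sup>2) = (\<Sum>u\<in>V. (real (nat \<lfloor>2 ^ k * z u\<rfloor>))\<^sup>2) / 4 ^ k" for z :: "'a \<Rightarrow> real"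
      by (simp add: app_def sum_divide_distrib power_divide power2_eq_square[of "2 ^ k"] flip: power_mult_distrib)
    ultimately show ?thesis
      using divide_right_mono[OF bilinear_nat_le[of ?X ?Y \<gamma>], of "4 ^ k"]
      by (simp add: add_divide_distrib[symmetric])
  qed
  show ?thesis
  proof (rule LIMSEQ_le)
    show "(\<lambda>k. \<bar>\<Sum>u\<in>V. \<Sum>v\<in>V. M u v * app (x u) k * app (y v) k\<bar>) \<longlonglongrightarrow> \<bar>\<Sum>u\<in>V. \<Sum>v\<in>V. M u v * x u * y v\<bar>"
      by (intro tendsto_intros app_lim assms)
    show "(\<lambda>k. gap_constant \<gamma> * ((\<Sum>u\<in>V. (app (x u) k)\<^sup>2) + (\<Sum>u\<in>V. (app (y u) k)\<^sup>2))) \<longlonglongrightarrow>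
        gap_constant \<gamma> * ((\<Sum>u\<in>V. (x u)\<^sup>2) + (\<Sum>u\<in>V. (y u)\<^sup>2))"
      by (intro tendsto_intros app_lim assms)
    show "\<exists>N. \<forall>n\<ge>N. \<bar>\<Sum>u\<in>V. \<Sum>v\<in>V. M u v * app (x u) n * app (y v) n\<bar> \<le>
     gap_constant \<gamma> * ((\<Sum>u\<in>V. (app (x u) n)\<^sup>2) + (\<Sum>u\<in>V. (app (y u) n)\<^sup>2))"
      using le by blast
  qed
qed

text \<open>The factor \<open>4\<close> is the price of splitting \<open>x\<close> into its positive and negative part.\<close>

theorem quadratic_form_le:
  fixes x :: "'a \<Rightarrow> real"
  shows "\<bar>\<Sum>u\<in>V. \<Sum>v\<in>V. M u v * x u * x v\<bar> \<le> 4 * gap_constant \<gamma> * (\<Sum>u\<in>V. (x u)\<^sup>2)"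
proof -
  define a where "a u = max (x u) 0" for u
  define b where "b u = max (- x u) 0" for u
  define P where "P = (\<Sum>u\<in>V. (a u)\<^sup>2)"
  define Q where "Q = (\<Sum>u\<in>V. (b u)\<^sup>2)"
  define F where "F y z = (\<Sum>u\<in>V. \<Sum>v\<in>V. M u v * y u * z v)" for y z :: "'a \<Rightarrow> real"
  have x: "x u = a u - b u" for u by (auto simp: a_def b_def)
  have sq: "(x u)\<^sup>2 = (a u)\<^sup>2 + (b u)\<^sup>2" for u by (auto simp: a_def b_def max_def)
  have "(\<Sum>u\<in>V. \<Sum>v\<in>V. M u v * x u * x v) = F a a - F a b - F b a + F b b"
    unfolding F_def x by (simp add: algebra_simps sum.distrib sum_subtractf)
  moreover have "\<bar>F a a\<bar> \<le> gap_constant \<gamma> * (P + P)" "\<bar>F a b\<bar> \<le> gap_constant \<gamma> * (P + Q)"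
      "\<bar>F b a\<bar> \<le> gap_constant \<gamma> * (Q + P)" "\<bar>F b b\<bar> \<le> gap_constant \<gamma> * (Q + Q)"
    unfolding F_def P_def Q_def by (intro bilinear_nonneg_le; simp add: a_def b_def)+
  moreover have "4 * gap_constant \<gamma> * (\<Sum>u\<in>V. (x u)\<^sup>2) =
      gap_constant \<gamma> * (P + P) + gap_constant \<gamma> * (P + Q) + gap_constant \<gamma> * (Q + P) + gap_constant \<gamma> * (Q + Q)"
    unfolding sq sum.distrib P_def Q_def by (simp add: algebra_simps)
  ultimately show ?thesis by linarith
qed

end

section \<open>Laplacian spectrum and entropy\<close>

text \<open>Jensen's inequality for the exponential, in the form of its tangent at the mean.\<close>

lemma gibbs_entropy_ge:
  fixes d :: "nat \<Rightarrow> real" and \<tau> :: real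
  assumes A: "A \<in> carrier_mat n n" and d: "spectral_decomp A U d" and n: "n > 0" and \<tau>: "\<tau> \<ge> 0"
    and nonneg: "\<And>i. i < n \<Longrightarrow> d i \<ge> 0"
  shows "von_neumann_entropy (gibbs_state \<tau> A) \<ge> ln n - \<tau> * (\<Sum>i<n. d i) / n"
proof -
  define Z where "Z = (\<Sum>i<n. exp (- \<tau> * d i))"
  define m where "m = - \<tau> * (\<Sum>i<n. d i) / n"
  have Z: "Z > 0" unfolding Z_def by (rule sum_pos) (use n in auto)
  have "(\<Sum>i<n. 1 + (- \<tau> * d i - m)) = n + (- \<tau> * (\<Sum>i<n. d i) - n * m)"
    by (simp add: sum.distrib sum_subtractf sum_distrib_left sum_negf)
  also have "\<dots> = n" using n by (simp add: m_def)
  finally have "exp m * n = (\<Sum>i<n. exp m * (1 + (- \<tau> * d i - m)))"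
    by (simp only: sum_distrib_left[symmetric])
  also have "\<dots> \<le> Z" unfolding Z_def
  proof (rule sum_mono)
    fix i
    have "exp m * (1 + (- \<tau> * d i - m)) \<le> exp m * exp (- \<tau> * d i - m)"
      by (intro mult_left_mono exp_ge_add_one_self) auto
    then show "exp m * (1 + (- \<tau> * d i - m)) \<le> exp (- \<tau> * d i)" by (simp flip: exp_add)
  qed
  finally have "ln (exp m * n) \<le> ln Z" using n Z by (subst ln_le_cancel_iff) auto
  then have "ln n + m \<le> ln Z" using n by (simp add: ln_mult)
  moreover have "0 \<le> \<tau> * (\<Sum>i<n. d i * exp (- \<tau> * d i)) / Z"
    using \<tau> nonneg Z by (intro divide_nonneg_nonneg mult_nonneg_nonneg sum_nonneg) auto
  ultimately show ?thesis
    unfolding gibbs_entropy_eq[OF A d n] Z_def[symmetric] m_def by simp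
qed

lemma mult_exp_minus_antimono:
  fixes x y :: real
  assumes "1 \<le> x" "x \<le> y"
  shows "y * exp (- y) \<le> x * exp (- x)"
proof -
  have "y / x \<le> exp (y / x - 1)" using exp_ge_add_one_self[of "y / x - 1"] by simp
  also have "y / x - 1 = (y - x) / x" using assms by (simp add: field_simps)
  also have "exp ((y - x) / x) \<le> exp (y - x)" 
    using mult_left_mono[of 1 x "y - x"] assms by (simp add: divide_le_eq)
  finally show ?thesis using assms by (simp add: exp_diff exp_minus field_simps)
qed

text \<open>Every eigenvalue other than \<open>d k\<close> contributes to \<open>Z - 1\<close> and to \<open>\<Sum>i. \<tau> d\<^sub>i e\<^bsup>-\<tau> d\<^sub>i\<^esup>\<close> at most what
  \<open>g\<close> would: the hypothesis \<open>\<tau> g \<ge> 1\<close> places it on the decreasing branch of \<open>y e\<^bsup>-y\<^esup>\<close>.\<close>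

lemma gibbs_entropy_le:
  fixes d :: "nat \<Rightarrow> real" and \<tau> g :: real
  assumes A: "A \<in> carrier_mat n n" and d: "spectral_decomp A U d" and \<tau>: "\<tau> > 0"
    and k: "k < n" "d k = 0" and gap: "\<And>i. i < n \<Longrightarrow> i \<noteq> k \<Longrightarrow> d i \<ge> g" and g: "\<tau> * g \<ge> 1"
  shows "\<bar>von_neumann_entropy (gibbs_state \<tau> A)\<bar> \<le> n * exp (- \<tau> * g) * (1 + \<tau> * g)"
proof -
  have n: "n > 0" using k by auto
  define Z where "Z = (\<Sum>i<n. exp (- \<tau> * d i))"
  define Y where "Y = (\<Sum>i<n. d i * exp (- \<tau> * d i))"
  have g0: "g > 0" using g \<tau> by (smt (verit) mult_nonneg_nonpos)
  have split: "(\<Sum>i<n. f i) = f k + (\<Sum>i\<in>{..<n} - {k}. f i)" for f :: "nat \<Rightarrow> real"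
    using k by (simp add: sum.remove)
  have cn: "real (card ({..<n} - {k})) \<le> n" using k by (simp add: card_Diff_subset)
  have Z1: "Z \<ge> 1" unfolding Z_def split by (simp add: k sum_nonneg)
  have "(\<Sum>i\<in>{..<n} - {k}. exp (- \<tau> * d i)) \<le> (\<Sum>i\<in>{..<n} - {k}. exp (- \<tau> * g))"
    using gap \<tau> by (intro sum_mono) auto
  also have "\<dots> \<le> n * exp (- \<tau> * g)" using cn by (simp add: mult_right_mono)
  finally have Z2: "Z - 1 \<le> n * exp (- \<tau> * g)" unfolding Z_def split by (simp add: k)
  have "\<tau> * Y = (\<Sum>i\<in>{..<n} - {k}. (\<tau> * d i) * exp (- (\<tau> * d i)))"
    unfolding Y_def split by (simp add: k sum_distrib_left mult_ac)
  also have "\<dots> \<le> (\<Sum>i\<in>{..<n} - {k}. (\<tau> * g) * exp (- (\<tau> * g)))"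
    using gap \<tau> g by (intro sum_mono mult_exp_minus_antimono) auto
  also have "\<dots> \<le> n * (\<tau> * g * exp (- (\<tau> * g)))" using g cn by (simp add: mult_right_mono)
  finally have Y2: "\<tau> * Y \<le> n * exp (- \<tau> * g) * (\<tau> * g)" by (simp add: mult_ac)
  have Y0: "Y \<ge> 0" unfolding Y_def
  proof (rule sum_nonneg)
    fix i assume "i \<in> {..<n}"
    then have "d i \<ge> 0" using gap[of i] k g0 by (cases "i = k") auto
    then show "d i * exp (- \<tau> * d i) \<ge> 0" by simp
  qed
  have "\<tau> * Y / Z \<le> \<tau> * Y" using mult_left_mono[OF Z1, of "\<tau> * Y"] Z1 Y0 \<tau> by (simp add: divide_le_eq)
  moreover have "0 \<le> \<tau> * Y / Z" using Z1 Y0 \<tau> by simp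
  moreover have "0 \<le> ln Z" "ln Z \<le> Z - 1" using Z1 by (auto intro: ln_le_minus_one)
  ultimately show ?thesis
    using Z2 Y2 unfolding gibbs_entropy_eq[OF A d n] Z_def[symmetric] Y_def[symmetric]
    by (simp add: distrib_left)
qed

definition adj :: "nat set set \<Rightarrow> nat \<Rightarrow> nat \<Rightarrow> real" where
  "adj E u v = of_bool ({u, v} \<in> E)"

definition deg :: "nat set set \<Rightarrow> nat \<Rightarrow> nat" where
  "deg E u = card {e \<in> E. u \<in> e}"

definition lap_form :: "nat \<Rightarrow> nat set set \<Rightarrow> (nat \<Rightarrow> real) \<Rightarrow> real" where
  "lap_form n E x = (\<Sum>u<n. real (deg E u) * (x u)\<^sup>2) - (\<Sum>u<n. \<Sum>v<n. adj E u v * x u * x v)"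

lemma finite_vertex_pairs [simp, intro]: "finite (vertex_pairs n)"
  by (rule finite_subset[of _ "Pow {..<n}"]) (auto simp: vertex_pairs_def)

lemma adj_commute: "adj E u v = adj E v u"
  by (simp add: adj_def insert_commute)

lemma adj_self: "E \<subseteq> vertex_pairs n \<Longrightarrow> adj E u u = 0"
  by (auto simp: adj_def vertex_pairs_def)

text \<open>For fixed \<open>u\<close>, the map \<open>v \<mapsto> {u, v}\<close> is a bijection from the neighbours to the incident edges.\<close>

lemma sum_incident:
  fixes f :: "nat set \<Rightarrow> real"
  assumes "E \<subseteq> vertex_pairs n" "u < n"
  shows "(\<Sum>v<n. of_bool ({u, v} \<in> E) * f {u, v}) = (\<Sum>e | e \<in> E \<and> u \<in> e. f e)"
proof -
  have "(\<Sum>v<n. of_bool ({u, v} \<in> E) * f {u, v}) = (\<Sum>v | v < n \<and> {u, v} \<in> E. f {u, v})"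
    by (rule sum.mono_neutral_cong_right) auto
  also have "\<dots> = (\<Sum>e | e \<in> E \<and> u \<in> e. f e)"
  proof (rule sum.reindex_bij_betw, rule bij_betwI')
    fix v w assume "v \<in> {v. v < n \<and> {u, v} \<in> E}" "w \<in> {v. v < n \<and> {u, v} \<in> E}"
    then have "card {u, v} = 2" "card {u, w} = 2" using assms by (auto simp: vertex_pairs_def)
    then show "({u, v} = {u, w}) = (v = w)" by (auto simp: doubleton_eq_iff)
  next
    fix e assume "e \<in> {e \<in> E. u \<in> e}"
    then have "e \<subseteq> {..<n}" "card e = 2" "u \<in> e" "e \<in> E" using assms by (auto simp: vertex_pairs_def)
    then obtain a b where "e = {a, b}" by (auto simp: card_2_iff)
    with \<open>u \<in> e\<close> obtain v where "e = {u, v}" by auto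
    then show "\<exists>v\<in>{v. v < n \<and> {u, v} \<in> E}. e = {u, v}"
      using \<open>e \<subseteq> _\<close> \<open>e \<in> E\<close> by auto
  qed auto
  finally show ?thesis .
qed

lemma sum_adj:
  assumes "E \<subseteq> vertex_pairs n" "u < n"
  shows "(\<Sum>v<n. adj E u v) = deg E u"
  using sum_incident[OF assms, of "\<lambda>_. 1"] by (simp add: adj_def deg_def)

lemma sum_deg:
  assumes "E \<subseteq> vertex_pairs n"
  shows "(\<Sum>u<n. deg E u) = 2 * card E"
proof -
  have fin: "finite E" using assms finite_subset by blast
  have "(\<Sum>u<n. deg E u) = (\<Sum>u<n. \<Sum>e\<in>E. of_bool (u \<in> e))"
    using fin by (simp add: deg_def Int_def)
  also have "\<dots> = (\<Sum>e\<in>E. \<Sum>u<n. of_bool (u \<in> e))" by (rule sum.swap)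
  also have "\<dots> = (\<Sum>e\<in>E. 2)"
  proof (rule sum.cong)
    fix e assume "e \<in> E"
    then have e: "e \<subseteq> {..<n}" "card e = 2" using assms by (auto simp: vertex_pairs_def)
    have "(\<Sum>u<n. of_bool (u \<in> e)) = card ({..<n} \<inter> e)" by simp
    also have "{..<n} \<inter> e = e" using e by auto
    finally show "(\<Sum>u<n. of_bool (u \<in> e)) = (2 :: nat)" using e by simp
  qed simp
  finally show ?thesis by simp
qed

lemma laplacian_carrier [simp]: "laplacian_mat n E \<in> carrier_mat n n"
  by (auto simp: laplacian_mat_def degree_mat_def adjacency_mat_def)

lemma laplacian_dim [simp]: "dim_row (laplacian_mat n E) = n" "dim_col (laplacian_mat n E) = n"
  by (rule carrier_matD[OF laplacian_carrier])+

lemma laplacian_index: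
  assumes "u < n" "v < n"
  shows "laplacian_mat n E $$ (u, v) = complex_of_real ((if u = v then real (deg E u) else 0) - adj E u v)"
  using assms by (auto simp: laplacian_mat_def degree_mat_def adjacency_mat_def mat_diag_def adj_def deg_def)

lemma laplacian_hermitian: "mat_adjoint (laplacian_mat n E) = laplacian_mat n E"
proof (rule eq_matI, goal_cases)
  case (1 i j)
  then show ?case by (auto simp: laplacian_index adj_commute)
qed auto

lemma laplacian_col_sum:
  assumes "E \<subseteq> vertex_pairs n" "v < n"
  shows "(\<Sum>u<n. laplacian_mat n E $$ (u, v)) = 0"
proof -
  have "(\<Sum>u<n. laplacian_mat n E $$ (u, v)) =
        complex_of_real ((\<Sum>u<n. if u = v then real (deg E u) else 0) - (\<Sum>u<n. adj E v u))"
    using assms by (simp add: laplacian_index sum_subtractf adj_commute[of E v] del: of_real_diff flip: of_real_sum) 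
  also have "\<dots> = 0" unfolding sum_adj[OF assms] using assms by simp
  finally show ?thesis .
qed

text \<open>The Laplacian is real, so its Hermitian form splits into the forms of the real and the imaginary
  part.\<close>

lemma laplacian_form:
  "Re (\<Sum>u<n. \<Sum>v<n. cnj (x u) * laplacian_mat n E $$ (u, v) * x v)
    = lap_form n E (\<lambda>u. Re (x u)) + lap_form n E (\<lambda>u. Im (x u))"
proof -
  have *: "lap_form n E y = (\<Sum>u<n. \<Sum>v<n. ((if u = v then real (deg E u) else 0) - adj E u v) * (y u * y v))" for y
  proof -
    have "(\<Sum>u<n. \<Sum>v<n. (if u = v then real (deg E u) else 0) * (y u * y v)) = (\<Sum>u<n. real (deg E u) * (y u)\<^sup>2)"
      by (intro sum.cong refl) (simp add: if_distrib[of "\<lambda>t. t * _"] power2_eq_square cong: if_cong)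
    then show ?thesis unfolding lap_form_def left_diff_distrib sum_subtractf by (simp add: mult.assoc)
  qed
  have "Re (cnj (x u) * complex_of_real r * x v) = r * (Re (x u) * Re (x v)) + r * (Im (x u) * Im (x v))" for r u v
    by (simp add: algebra_simps)
  then show ?thesis unfolding *
    by (simp add: laplacian_index sum.distrib mult_ac)
qed

lemma lap_form_nonneg:
  assumes E: "E \<subseteq> vertex_pairs n"
  shows "lap_form n E x \<ge> 0"
proof -
  have s: "(\<Sum>u<n. real (deg E u) * (x u)\<^sup>2) = (\<Sum>u<n. \<Sum>v<n. adj E u v * (x u)\<^sup>2)"
    using sum_adj[OF E] by (intro sum.cong refl) (simp flip: sum_distrib_right)
  have s': "(\<Sum>u<n. \<Sum>v<n. adj E u v * (x u)\<^sup>2) = (\<Sum>u<n. \<Sum>v<n. adj E u v * (x v)\<^sup>2)"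
    by (subst sum.swap) (simp add: adj_commute)
  have "0 \<le> (\<Sum>u<n. \<Sum>v<n. adj E u v * (x u - x v)\<^sup>2)"
    by (intro sum_nonneg mult_nonneg_nonneg) (auto simp: adj_def)
  also have "\<dots> = (\<Sum>u<n. \<Sum>v<n. adj E u v * (x u)\<^sup>2) + (\<Sum>u<n. \<Sum>v<n. adj E u v * (x v)\<^sup>2)
     - 2 * (\<Sum>u<n. \<Sum>v<n. adj E u v * x u * x v)"
    by (simp add: sum.distrib sum_subtractf sum_distrib_left power2_diff algebra_simps)
  finally show ?thesis using s s' by (simp add: lap_form_def)
qed

lemma spectral_decomp_eigen:
  assumes A: "A \<in> carrier_mat n n" and d: "spectral_decomp A U d"
  shows "\<And>i j. i < n \<Longrightarrow> j < n \<Longrightarrow> (\<Sum>u<n. cnj (U $$ (u, i)) * U $$ (u, j)) = of_bool (i = j)"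
    and "\<And>u v. u < n \<Longrightarrow> v < n \<Longrightarrow> (\<Sum>i<n. U $$ (u, i) * cnj (U $$ (v, i))) = of_bool (u = v)"
    and "\<And>u i. u < n \<Longrightarrow> i < n \<Longrightarrow> (\<Sum>v<n. A $$ (u, v) * U $$ (v, i)) = d i * U $$ (u, i)"
proof -
  note U = spectral_decompD[OF d A]
  show 1: "(\<Sum>u<n. cnj (U $$ (u, i)) * U $$ (u, j)) = of_bool (i = j)" if "i < n" "j < n" for i j
    using arg_cong[OF U(2), of "\<lambda>M. M $$ (i,j)"] U(1) that
    by (simp add: scalar_prod_def atLeast0LessThan of_bool_def)
  show "(\<Sum>i<n. U $$ (u, i) * cnj (U $$ (v, i))) = of_bool (u = v)" if "u < n" "v < n" for u v
    using arg_cong[OF U(3), of "\<lambda>M. M $$ (u,v)"] U(1) that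
    by (simp add: scalar_prod_def atLeast0LessThan of_bool_def)
  show "(\<Sum>v<n. A $$ (u, v) * U $$ (v, i)) = d i * U $$ (u, i)" if "u < n" "i < n" for u i
  proof -
    have "(\<Sum>v<n. A $$ (u, v) * U $$ (v, i)) = (\<Sum>v<n. \<Sum>l<n. U $$ (u,l) * d l * (cnj (U $$ (v,l)) * U $$ (v, i)))"
      using that unfolding U(4) by (simp add: diag_conj_index[OF U(1)] sum_distrib_right mult.assoc)
    also have "\<dots> = (\<Sum>l<n. U $$ (u,l) * d l * (\<Sum>v<n. cnj (U $$ (v,l)) * U $$ (v, i)))"
      by (subst sum.swap) (simp add: sum_distrib_left)
    also have "\<dots> = (\<Sum>l<n. U $$ (u,l) * d l * of_bool (l = i))"
      using that by (intro sum.cong refl) (simp add: 1)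
    finally show ?thesis using that by (simp add: of_bool_def if_distrib mult.commute cong: if_cong)
  qed
qed

lemma laplacian_eigenvalue_form:
  assumes d: "spectral_decomp (laplacian_mat n E) U d" and i: "i < n"
  shows "d i = lap_form n E (\<lambda>u. Re (U $$ (u, i))) + lap_form n E (\<lambda>u. Im (U $$ (u, i)))"
proof -
  note eig = spectral_decomp_eigen[OF laplacian_carrier d]
  have "(\<Sum>u<n. \<Sum>v<n. cnj (U $$ (u, i)) * laplacian_mat n E $$ (u, v) * U $$ (v, i)) =
     (\<Sum>u<n. cnj (U $$ (u, i)) * (d i * U $$ (u, i)))"
    using i by (intro sum.cong refl) (simp add: eig(3)[symmetric] sum_distrib_left mult_ac)
  also have "\<dots> = d i * (\<Sum>u<n. cnj (U $$ (u, i)) * U $$ (u, i))"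
    by (simp add: sum_distrib_left mult_ac)
  also have "\<dots> = d i" using eig(1)[OF i i] by simp
  finally show ?thesis using laplacian_form[where n = n and x = "\<lambda>u. U $$ (u, i)" and E = E] by simp
qed

theorem laplacian_entropy_ge:
  fixes \<tau> :: real
  assumes E: "E \<subseteq> vertex_pairs n" and n: "n > 0" and \<tau>: "\<tau> \<ge> 0"
  shows "von_neumann_entropy (gibbs_state \<tau> (laplacian_mat n E)) \<ge> ln n - \<tau> * (2 * card E) / n"
proof -
  obtain U d where d: "spectral_decomp (laplacian_mat n E) U d"
    using hermitian_spectral_decomp[OF laplacian_carrier laplacian_hermitian] by blast
  note U = spectral_decompD[OF d laplacian_carrier]
  have "complex_of_real (\<Sum>i<n. d i) = mat_trace (laplacian_mat n E)"
    unfolding U(4) diag_conj_trace[OF U(1,2)] by simp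
  also have "\<dots> = complex_of_real (\<Sum>u<n. real (deg E u))"
    by (simp add: mat_trace_def laplacian_index adj_self[OF E])
  also have "(\<Sum>u<n. real (deg E u)) = 2 * card E"
    using sum_deg[OF E] by (simp flip: of_nat_sum)
  finally have "(\<Sum>i<n. d i) = 2 * card E" by (simp only: of_real_eq_iff)
  moreover have "d i \<ge> 0" if "i < n" for i
    using laplacian_eigenvalue_form[OF d that] by (simp add: lap_form_nonneg[OF E])
  ultimately show ?thesis
    using gibbs_entropy_ge[OF laplacian_carrier d n \<tau>] by simp
qed

text \<open>Write \<open>s\<^sub>i\<close> for the sum of the entries of the \<open>i\<close>-th eigenvector.  As the columns of the Laplacian
  sum to zero, \<open>s\<^sub>i d\<^sub>i = 0\<close>; and \<open>s\<^sub>i = 0\<close> forces \<open>d\<^sub>i \<ge> g\<close>.  Not all \<open>s\<^sub>i\<close> vanish, since the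
  eigenvectors span; and if \<open>d\<^sub>i = d\<^sub>j = 0\<close> then the eigenvectors combine to a kernel vector with entry
  sum zero, which is excluded by the bound on the form.\<close>

lemma laplacian_simple_kernel:
  fixes g :: real
  assumes E: "E \<subseteq> vertex_pairs n" and n: "n > 0" and g: "g > 0"
    and gap: "\<And>x :: nat \<Rightarrow> real. (\<Sum>u<n. x u) = 0 \<Longrightarrow> lap_form n E x \<ge> g * (\<Sum>u<n. (x u)\<^sup>2)"
    and d: "spectral_decomp (laplacian_mat n E) U d"
  shows "\<exists>k<n. d k = 0 \<and> (\<forall>i<n. i \<noteq> k \<longrightarrow> d i \<ge> g)"
proof -
  note eig = spectral_decomp_eigen[OF laplacian_carrier d]
  have cgap: "Re (\<Sum>u<n. \<Sum>v<n. cnj (x u) * laplacian_mat n E $$ (u, v) * x v) \<ge> g * (\<Sum>u<n. (cmod (x u))\<^sup>2)"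
    if "(\<Sum>u<n. x u) = 0" for x
  proof -
    have "(\<Sum>u<n. Re (x u)) = 0" "(\<Sum>u<n. Im (x u)) = 0" using that by (simp_all flip: Re_sum Im_sum)
    from gap[OF this(1)] gap[OF this(2)] show ?thesis
      unfolding laplacian_form cmod_power2 by (simp add: sum.distrib distrib_left)
  qed
  have unit: "(\<Sum>u<n. (cmod (U $$ (u, i)))\<^sup>2) = 1" if "i < n" for i
  proof -
    have "complex_of_real (\<Sum>u<n. (cmod (U $$ (u, i)))\<^sup>2) = (\<Sum>u<n. cnj (U $$ (u, i)) * U $$ (u, i))"
      by (simp add: complex_norm_square mult.commute del: of_real_power)
    then show ?thesis using eig(1)[OF that that] by (metis of_bool_eq(2) of_real_1 of_real_eq_iff)
  qed
  define s where "s i = (\<Sum>u<n. U $$ (u, i))" for i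
  have sd: "s i = 0 \<or> d i = 0" if i: "i < n" for i
  proof -
    have "d i * s i = (\<Sum>u<n. \<Sum>v<n. laplacian_mat n E $$ (u, v) * U $$ (v, i))"
      unfolding s_def sum_distrib_left using eig(3) i by (intro sum.cong) auto
    also have "\<dots> = (\<Sum>v<n. (\<Sum>u<n. laplacian_mat n E $$ (u, v)) * U $$ (v, i))"
      by (subst sum.swap) (simp add: sum_distrib_right)
    also have "\<dots> = 0" using laplacian_col_sum[OF E] by simp
    finally show ?thesis by auto
  qed
  have large: "d i \<ge> g" if i: "i < n" "s i = 0" for i
    using cgap[of "\<lambda>u. U $$ (u, i)"] i unit[OF i(1)] laplacian_eigenvalue_form[OF d i(1)]
      laplacian_form[where n = n and x = "\<lambda>u. U $$ (u, i)" and E = E]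
    by (simp add: s_def)
  have "\<exists>k<n. s k \<noteq> 0"
  proof (rule ccontr)
    assume "\<not> (\<exists>k<n. s k \<noteq> 0)"
    then have "0 = (\<Sum>i<n. s i * cnj (U $$ (0, i)))" by simp
    also have "\<dots> = (\<Sum>i<n. \<Sum>u<n. U $$ (u, i) * cnj (U $$ (0, i)))"
      by (simp add: s_def sum_distrib_right)
    also have "\<dots> = (\<Sum>u<n. \<Sum>i<n. U $$ (u, i) * cnj (U $$ (0, i)))" by (rule sum.swap)
    also have "\<dots> = (\<Sum>u<n. of_bool (u = 0))" using n by (intro sum.cong refl eig(2)) auto
    also have "\<dots> = 1" using n by (simp add: of_bool_def)
    finally show False by simp
  qed
  then obtain k where k: "k < n" "s k \<noteq> 0" by blast
  have dk: "d k = 0" using sd k by blast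
  have "d i \<ge> g" if i: "i < n" "i \<noteq> k" for i
  proof (rule ccontr)
    assume "\<not> d i \<ge> g"
    then have di: "d i = 0" using large sd i by blast
    define x where "x u = s k * U $$ (u, i) - s i * U $$ (u, k)" for u
    have "(\<Sum>u<n. x u) = 0" by (simp add: x_def sum_subtractf s_def flip: sum_distrib_left)
    moreover have "(\<Sum>v<n. laplacian_mat n E $$ (u, v) * x v) = 0" if "u < n" for u
    proof -
      have "(\<Sum>v<n. laplacian_mat n E $$ (u, v) * x v) =
         s k * (\<Sum>v<n. laplacian_mat n E $$ (u, v) * U $$ (v, i)) - s i * (\<Sum>v<n. laplacian_mat n E $$ (u, v) * U $$ (v, k))"
        by (simp add: x_def sum_distrib_left sum_subtractf algebra_simps)
      then show ?thesis using eig(3)[OF that i(1)] eig(3)[OF that k(1)] di dk by simp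
    qed
    then have "(\<Sum>u<n. \<Sum>v<n. cnj (x u) * laplacian_mat n E $$ (u, v) * x v) = 0"
      by (simp add: mult.assoc flip: sum_distrib_left)
    ultimately have "g * (\<Sum>u<n. (cmod (x u))\<^sup>2) \<le> 0" using cgap[of x] by simp
    then have "(\<Sum>u<n. (cmod (x u))\<^sup>2) \<le> 0" using g by (simp add: mult_le_0_iff)
    then have "(\<Sum>u<n. (cmod (x u))\<^sup>2) = 0" by (meson order.antisym sum_nonneg zero_le_power2)
    then have x0: "x u = 0" if "u < n" for u using that by (subst (asm) sum_nonneg_eq_0_iff) auto
    have "0 = (\<Sum>u<n. cnj (U $$ (u, i)) * x u)" using x0 by simp
    also have "\<dots> = s k * (\<Sum>u<n. cnj (U $$ (u, i)) * U $$ (u, i)) - s i * (\<Sum>u<n. cnj (U $$ (u, i)) * U $$ (u, k))"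
      by (simp add: x_def sum_distrib_left sum_subtractf algebra_simps)
    also have "\<dots> = s k" using eig(1)[OF i(1) i(1)] eig(1)[OF i(1) k(1)] i by simp
    finally show False using k by simp
  qed
  then show ?thesis using k dk by blast
qed

theorem laplacian_entropy_le:
  fixes \<tau> g :: real
  assumes E: "E \<subseteq> vertex_pairs n" and n: "n > 0" and \<tau>: "\<tau> > 0" and g: "\<tau> * g \<ge> 1"
    and gap: "\<And>x :: nat \<Rightarrow> real. (\<Sum>u<n. x u) = 0 \<Longrightarrow> lap_form n E x \<ge> g * (\<Sum>u<n. (x u)\<^sup>2)"
  shows "\<bar>von_neumann_entropy (gibbs_state \<tau> (laplacian_mat n E))\<bar> \<le> n * exp (- \<tau> * g) * (1 + \<tau> * g)"
proof -
  obtain U d where d: "spectral_decomp (laplacian_mat n E) U d"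
    using hermitian_spectral_decomp[OF laplacian_carrier laplacian_hermitian] by blast
  have "g > 0" using g \<tau> by (smt (verit) mult_nonneg_nonpos)
  from laplacian_simple_kernel[OF E n this gap d] obtain k where
    "k < n" "d k = 0" "\<And>i. i < n \<Longrightarrow> i \<noteq> k \<Longrightarrow> d i \<ge> g" by blast
  then show ?thesis by (intro gibbs_entropy_le[OF laplacian_carrier d \<tau>]) (use g in auto)
qed

text \<open>With a zero diagonal, the sum over a rectangle involves edges only; compared with subtracting \<open>p\<close>
  everywhere this changes the form by \<open>p \<parallel>x\<parallel>\<^sup>2\<close>, which has the favourable sign in \<open>laplacian_gap\<close>.\<close>

definition centred :: "real \<Rightarrow> nat set set \<Rightarrow> nat \<Rightarrow> nat \<Rightarrow> real" where
  "centred p E u v = (if u = v then 0 else adj E u v - p)"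

lemma centred_row_sum_le:
  fixes p :: real
  assumes E: "E \<subseteq> vertex_pairs n" and p: "p \<ge> 0" and u: "u < n"
  shows "(\<Sum>v<n. \<bar>centred p E u v\<bar>) \<le> deg E u + p * n"
proof -
  have "(\<Sum>v<n. \<bar>centred p E u v\<bar>) \<le> (\<Sum>v<n. adj E u v + p)"
    using p by (intro sum_mono) (auto simp: centred_def adj_def)
  also have "\<dots> = deg E u + p * n" using sum_adj[OF E u] by (simp add: sum.distrib)
  finally show ?thesis .
qed

text \<open>For entry sum \<open>0\<close> the adjacency form is at most the form of the centred matrix, as the rank-one part
  \<open>p (\<Sum>u. x u)\<^sup>2\<close> vanishes.\<close>

theorem laplacian_gap:
  fixes p c \<alpha> \<Delta> :: real and x :: "nat \<Rightarrow> real" and \<gamma> :: nat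
  assumes E: "E \<subseteq> vertex_pairs n" and p: "p \<ge> 0"
    and lower: "\<And>u. u < n \<Longrightarrow> c \<le> deg E u" and upper: "\<And>u. u < n \<Longrightarrow> deg E u + p * n \<le> \<Delta>"
    and disc: "\<And>S T. S \<subseteq> {..<n} \<Longrightarrow> T \<subseteq> {..<n} \<Longrightarrow>
        \<bar>\<Sum>u\<in>S. \<Sum>v\<in>T. centred p E u v\<bar> \<le> \<alpha> * sqrt (card S * card T)"
    and "\<alpha> \<ge> 0" "\<Delta> \<ge> 0" and x: "(\<Sum>u<n. x u) = 0"
  shows "lap_form n E x \<ge> (c - (2 * \<alpha> * (2 * real \<gamma> + 1) + 4 * \<Delta> / 2 ^ \<gamma>)) * (\<Sum>u<n. (x u)\<^sup>2)"
proof -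
  interpret discrepancy_bounded "{..<n}" "centred p E" \<alpha> \<Delta>
  proof
    fix u assume u: "u \<in> {..<n}"
    then show "(\<Sum>v<n. \<bar>centred p E u v\<bar>) \<le> \<Delta>"
      using centred_row_sum_le[OF E p, of u] upper[of u] by simp
  qed (use assms in \<open>auto simp: centred_def adj_commute\<close>)
  have pp: "(\<Sum>u<n. \<Sum>v<n. p * (x u * x v)) = p * ((\<Sum>u<n. x u) * (\<Sum>u<n. x u))"
    by (subst sum_product) (simp only: sum_distrib_left)
  have "(\<Sum>u<n. \<Sum>v<n. adj E u v * x u * x v) = (\<Sum>u<n. \<Sum>v<n. centred p E u v * x u * x v + p * (x u * x v) - (if v = u then p * (x u)\<^sup>2 else 0))"
    using adj_self[OF E] by (intro sum.cong refl) (auto simp: centred_def algebra_simps power2_eq_square)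
  also have "\<dots> = (\<Sum>u<n. \<Sum>v<n. centred p E u v * x u * x v) + p * ((\<Sum>u<n. x u) * (\<Sum>u<n. x u)) - (\<Sum>u<n. p * (x u)\<^sup>2)"
    by (simp add: sum.distrib sum_subtractf pp)
  also have "\<dots> \<le> (\<Sum>u<n. \<Sum>v<n. centred p E u v * x u * x v)"
    using p by (simp add: x sum_nonneg)
  also have "\<dots> \<le> 4 * gap_constant \<gamma> * (\<Sum>u<n. (x u)\<^sup>2)" using quadratic_form_le[of x \<gamma>] by linarith
  finally have "(\<Sum>u<n. \<Sum>v<n. adj E u v * x u * x v) \<le> 4 * gap_constant \<gamma> * (\<Sum>u<n. (x u)\<^sup>2)" .
  moreover have "c * (\<Sum>u<n. (x u)\<^sup>2) \<le> (\<Sum>u<n. real (deg E u) * (x u)\<^sup>2)"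
    unfolding sum_distrib_left using lower by (intro sum_mono mult_right_mono) auto
  moreover have "4 * gap_constant \<gamma> = 2 * \<alpha> * (2 * real \<gamma> + 1) + 4 * \<Delta> / 2 ^ \<gamma>"
    by (simp add: gap_constant_def)
  ultimately show ?thesis
    by (simp add: lap_form_def left_diff_distrib)
qed

section \<open>Concentration in the random graph\<close>

lemma set_erdos_renyi_subset: "E \<in> set_pmf (erdos_renyi n p) \<Longrightarrow> E \<subseteq> vertex_pairs n"
  by (auto simp: erdos_renyi_def)

text \<open>The exponential moment of a weighted edge count is a product over the vertex pairs; the bound
  is Markov's inequality followed by \<open>1 + x \<le> e\<^sup>x\<close> in each factor.\<close>

lemma erdos_renyi_chernoff:
  fixes g :: "nat set \<Rightarrow> real"
  assumes p: "0 \<le> p" "p \<le> 1"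
  shows "measure_pmf.prob (erdos_renyi n p) {E. a \<le> (\<Sum>e\<in>E. g e)}
          \<le> exp (p * (\<Sum>e\<in>vertex_pairs n. exp (g e) - 1) - a)"
proof -
  define D where "D = Pi_pmf (vertex_pairs n) False (\<lambda>_. bernoulli_pmf p)"
  have fin: "finite (set_pmf D)"
    unfolding D_def by (subst set_Pi_pmf) (auto intro!: finite_PiE_dflt)
  define h where "h e b = (if b then exp (g e) else 1)" for e b
  have h: "exp (\<Sum>e\<in>{e \<in> vertex_pairs n. f e}. g e) = (\<Prod>e\<in>vertex_pairs n. h e (f e))" for f
    by (simp add: exp_sum h_def prod.inter_filter)
  have "measure_pmf.prob (erdos_renyi n p) {E. a \<le> (\<Sum>e\<in>E. g e)} =
      measure_pmf.prob D {f. a \<le> (\<Sum>e\<in>{e \<in> vertex_pairs n. f e}. g e)}"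
    by (simp add: erdos_renyi_def D_def vimage_def)
  also have "\<dots> = measure_pmf.expectation D (indicator {f. a \<le> (\<Sum>e\<in>{e \<in> vertex_pairs n. f e}. g e)})"
    by simp
  also have "\<dots> \<le> measure_pmf.expectation D (\<lambda>f. exp (- a) * (\<Prod>e\<in>vertex_pairs n. h e (f e)))"
  proof (rule integral_mono)
    fix f
    show "indicator {f. a \<le> (\<Sum>e\<in>{e \<in> vertex_pairs n. f e}. g e)} f \<le> exp (- a) * (\<Prod>e\<in>vertex_pairs n. h e (f e))"
      unfolding h[symmetric] by (auto simp: indicator_def simp flip: exp_add)
  qed (auto intro: integrable_measure_pmf_finite fin)
  also have "\<dots> = exp (- a) * measure_pmf.expectation D (\<lambda>f. \<Prod>e\<in>vertex_pairs n. h e (f e))"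
    by simp
  also have "measure_pmf.expectation D (\<lambda>f. \<Prod>e\<in>vertex_pairs n. h e (f e)) =
     (\<Prod>e\<in>vertex_pairs n. measure_pmf.expectation (bernoulli_pmf p) (h e))"
    unfolding D_def by (rule expectation_prod_Pi_pmf) (auto intro: integrable_measure_pmf_finite simp: h_def)
  also have "\<dots> = (\<Prod>e\<in>vertex_pairs n. 1 + p * (exp (g e) - 1))"
    using p by (intro prod.cong) (auto simp: h_def algebra_simps)
  also have "\<dots> \<le> (\<Prod>e\<in>vertex_pairs n. exp (p * (exp (g e) - 1)))"
  proof (rule prod_mono, intro conjI)
    fix e
    have "0 \<le> (1 - p) + p * exp (g e)" using p by simp
    then show "0 \<le> 1 + p * (exp (g e) - 1)" by (simp add: algebra_simps)
    show "1 + p * (exp (g e) - 1) \<le> exp (p * (exp (g e) - 1))" by (rule exp_ge_add_one_self)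
  qed
  also have "\<dots> = exp (p * (\<Sum>e\<in>vertex_pairs n. exp (g e) - 1))"
    by (simp add: exp_sum sum_distrib_left)
  finally show ?thesis by (simp add: exp_diff exp_minus field_simps)
qed

lemma prob_erdos_renyi_mono:
  assumes "\<And>E. E \<subseteq> vertex_pairs n \<Longrightarrow> P E \<Longrightarrow> Q E"
  shows "measure_pmf.prob (erdos_renyi n p) {E. P E} \<le> measure_pmf.prob (erdos_renyi n p) {E. Q E}"
  by (rule measure_pmf.finite_measure_mono_AE)
    (auto simp: AE_measure_pmf_iff dest!: set_erdos_renyi_subset intro: assms)

lemma prob_erdos_renyi_union_bound:
  assumes "finite I" "\<And>i. i \<in> I \<Longrightarrow> measure_pmf.prob (erdos_renyi n p) {E. Q i E} \<le> b i"
  shows "measure_pmf.prob (erdos_renyi n p) {E. \<exists>i\<in>I. Q i E} \<le> (\<Sum>i\<in>I. b i)"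
proof -
  have "{E. \<exists>i\<in>I. Q i E} = (\<Union>i\<in>I. {E. Q i E})" by auto
  also have "measure_pmf.prob (erdos_renyi n p) \<dots> \<le> (\<Sum>i\<in>I. measure_pmf.prob (erdos_renyi n p) {E. Q i E})"
    by (rule measure_pmf.finite_measure_subadditive_finite) (use assms in auto)
  also have "\<dots> \<le> (\<Sum>i\<in>I. b i)" by (intro sum_mono assms)
  finally show ?thesis .
qed

lemma deg_complete: "u < n \<Longrightarrow> deg (vertex_pairs n) u = n - 1"
proof -
  assume u: "u < n"
  have "real (deg (vertex_pairs n) u) = (\<Sum>v<n. of_bool (v \<noteq> u))"
    unfolding sum_adj[OF order.refl u, symmetric]
  proof (intro sum.cong refl)
    fix v assume "v \<in> {..<n}"
    then have "{u, v} \<in> vertex_pairs n \<longleftrightarrow> v \<noteq> u" using u by (auto simp: vertex_pairs_def card_2_iff')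
    then show "adj (vertex_pairs n) u v = of_bool (v \<noteq> u)" by (simp add: adj_def)
  qed
  also have "\<dots> = real (card ({..<n} - {u}))" by (simp add: Int_def set_diff_eq)
  finally show ?thesis using u by simp
qed

lemma sum_incident_indicator:
  assumes "E \<subseteq> vertex_pairs n"
  shows "(\<Sum>e\<in>E. c * of_bool (u \<in> e)) = (c :: real) * deg E u"
    and "(\<Sum>e\<in>E. exp (c * of_bool (u \<in> e)) - 1) = (exp c - 1) * deg E u"
proof -
  have fin: "finite E" using assms finite_subset by blast
  then show 1: "(\<Sum>e\<in>E. c * of_bool (u \<in> e)) = (c :: real) * deg E u" for c
    by (simp add: deg_def Int_def flip: sum_distrib_left)
  have "(\<Sum>e\<in>E. exp (c * of_bool (u \<in> e)) - 1) = (\<Sum>e\<in>E. (exp c - 1) * of_bool (u \<in> e))"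
    by (intro sum.cong) auto
  then show "(\<Sum>e\<in>E. exp (c * of_bool (u \<in> e)) - 1) = (exp c - 1) * deg E u"
    using 1 by simp
qed

lemma card_vertex_pairs: "2 * card (vertex_pairs n) = n * (n - 1)"
  using sum_deg[of "vertex_pairs n" n] by (simp add: deg_complete)

lemma prob_deg_ge:
  fixes a c p :: real
  assumes p: "0 \<le> p" "p \<le> 1" and u: "u < n"
  shows "measure_pmf.prob (erdos_renyi n p) {E. a \<le> c * real (deg E u)} \<le> exp (p * ((exp c - 1) * (real n - 1)) - a)"
proof -
  have "measure_pmf.prob (erdos_renyi n p) {E. a \<le> c * real (deg E u)} \<le>
      measure_pmf.prob (erdos_renyi n p) {E. a \<le> (\<Sum>e\<in>E. c * of_bool (u \<in> e))}"
    by (rule prob_erdos_renyi_mono) (simp add: sum_incident_indicator)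
  also have "\<dots> \<le> exp (p * ((exp c - 1) * (real n - 1)) - a)"
    using erdos_renyi_chernoff[OF p, of n a "\<lambda>e. c * of_bool (u \<in> e)"] u
    by (simp add: sum_incident_indicator[OF order.refl] deg_complete of_nat_diff)
  finally show ?thesis .
qed

lemma prob_tendsto_0:
  fixes M :: "nat \<Rightarrow> 'a pmf"
  assumes "eventually (\<lambda>n. measure_pmf.prob (M n) (A n) \<le> b n) sequentially" "b \<longlonglongrightarrow> 0"
  shows "(\<lambda>n. measure_pmf.prob (M n) (A n)) \<longlonglongrightarrow> 0"
  by (rule tendsto_sandwich[OF _ assms(1) tendsto_const assms(2)]) simp

context
  fixes p\<^sub>0 :: real and p :: "nat \<Rightarrow> real"
  assumes p\<^sub>0: "p\<^sub>0 > 0" and p_def: "\<And>n. p n = p\<^sub>0 * ln (real n) / n"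
begin

lemma eventually_p: "eventually (\<lambda>n. 0 \<le> p n \<and> p n \<le> 1) sequentially"
proof -
  have "eventually (\<lambda>n. p\<^sub>0 * ln (real n) / real n < 1) sequentially" by real_asymp
  moreover have "eventually (\<lambda>n. 0 \<le> p\<^sub>0 * ln (real n) / real n) sequentially"
    using p\<^sub>0 by real_asymp
  ultimately show ?thesis unfolding p_def by eventually_elim auto
qed

lemma max_degree:
  obtains K where "K > 0" "(\<lambda>n. measure_pmf.prob (erdos_renyi n (p n)) {E. \<exists>u\<in>{..<n}. K * ln (real n) \<le> real (deg E u)}) \<longlonglongrightarrow> 0"
proof
  \<comment> \<open>Chernoff's bound with parameter \<open>1\<close> then gives \<open>n\<^bsup>-2\<^esup>\<close> per vertex.\<close>
  define K where "K = 2 + p\<^sub>0 * (exp 1 - 1)"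
  have e1: "exp 1 - 1 > (0::real)" by (simp add: exp_gt_one)
  show "K > 0" using p\<^sub>0 e1 by (simp add: K_def add_pos_pos)
  show "(\<lambda>n. measure_pmf.prob (erdos_renyi n (p n)) {E. \<exists>u\<in>{..<n}. K * ln (real n) \<le> real (deg E u)}) \<longlonglongrightarrow> 0"
  proof (rule prob_tendsto_0)
    show "eventually (\<lambda>n. measure_pmf.prob (erdos_renyi n (p n)) {E. \<exists>u\<in>{..<n}. K * ln (real n) \<le> real (deg E u)} \<le> 1 / n) sequentially"
      using eventually_p eventually_gt_at_top[of 0]
    proof eventually_elim
      case (elim n)
      have "measure_pmf.prob (erdos_renyi n (p n)) {E. K * ln (real n) \<le> real (deg E u)} \<le> 1 / n\<^sup>2" if u: "u < n" for u
      proof -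
        have "measure_pmf.prob (erdos_renyi n (p n)) {E. K * ln (real n) \<le> real (deg E u)} \<le>
            exp (p n * ((exp 1 - 1) * (real n - 1)) - K * ln (real n))"
          using prob_deg_ge[of "p n" u n "K * ln (real n)" 1] elim u by simp
        also have "p n * ((exp 1 - 1) * (real n - 1)) \<le> p n * ((exp 1 - 1) * real n)"
          using elim e1 by (intro mult_left_mono) auto
        also have "\<dots> = p\<^sub>0 * (exp 1 - 1) * ln (real n)" using elim by (simp add: p_def)
        also have "p\<^sub>0 * (exp 1 - 1) * ln (real n) - K * ln (real n) = - (2 * ln (real n))" by (simp add: K_def algebra_simps)
        also have "exp (- (2 * ln (real n))) = 1 / n\<^sup>2"
          using elim by (simp add: exp_minus exp_double divide_inverse)
        finally show ?thesis by simp
      qed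
      then have "measure_pmf.prob (erdos_renyi n (p n)) {E. \<exists>u\<in>{..<n}. K * ln (real n) \<le> real (deg E u)} \<le> (\<Sum>u<n. 1 / n\<^sup>2)"
        by (intro prob_erdos_renyi_union_bound) auto
      also have "\<dots> = 1 / n" using elim by (simp add: power2_eq_square)
      finally show ?case .
    qed
  qed real_asymp
qed

lemma min_degree:
  assumes c: "0 < c" "c < p\<^sub>0" "1 + c * ln (p\<^sub>0 / c) - p\<^sub>0 + c < 0"
  shows "(\<lambda>n. measure_pmf.prob (erdos_renyi n (p n)) {E. \<exists>u\<in>{..<n}. real (deg E u) \<le> c * ln (real n)}) \<longlonglongrightarrow> 0"
proof (rule prob_tendsto_0)
  \<comment> \<open>The optimal parameter: it minimises \<open>p\<^sub>0 (e\<^bsup>-\<theta>\<^esup> - 1) + \<theta> c\<close>.\<close>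
  define \<theta> where "\<theta> = ln (p\<^sub>0 / c)"
  define \<delta> where "\<delta> = - (1 + c * ln (p\<^sub>0 / c) - p\<^sub>0 + c)"
  have \<theta>: "\<theta> > 0" "exp (- \<theta>) = c / p\<^sub>0" using c p\<^sub>0 by (auto simp: \<theta>_def exp_minus)
  let ?b = "\<lambda>n. exp ((- \<delta> + (p\<^sub>0 - c) / real n) * ln (real n))"
  show "eventually (\<lambda>n. measure_pmf.prob (erdos_renyi n (p n)) {E. \<exists>u\<in>{..<n}. real (deg E u) \<le> c * ln (real n)} \<le> ?b n) sequentially"
    using eventually_p eventually_gt_at_top[of 0]
  proof eventually_elim
    case (elim n)
    define B where "B = exp (p n * ((exp (- \<theta>) - 1) * (real n - 1)) - (- \<theta> * (c * ln (real n))))"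
    have "measure_pmf.prob (erdos_renyi n (p n)) {E. real (deg E u) \<le> c * ln (real n)} \<le> B" if u: "u < n" for u
    proof -
      have "{E. real (deg E u) \<le> c * ln (real n)} = {E. - \<theta> * (c * ln (real n)) \<le> - \<theta> * real (deg E u)}"
        using \<theta> by auto
      then show ?thesis
        using prob_deg_ge[of "p n" u n "- \<theta> * (c * ln (real n))" "- \<theta>"] elim u by (simp add: B_def)
    qed
    then have "measure_pmf.prob (erdos_renyi n (p n)) {E. \<exists>u\<in>{..<n}. real (deg E u) \<le> c * ln (real n)} \<le> (\<Sum>u<n. B)"
      by (intro prob_erdos_renyi_union_bound) auto
    also have "\<dots> = exp (ln (real n)) * B" using elim by simp
    also have "\<dots> = exp (ln (real n) + (p n * ((exp (- \<theta>) - 1) * (real n - 1)) - (- \<theta> * (c * ln (real n)))))"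
      by (simp only: B_def exp_add)
    also have "ln (real n) + (p n * ((exp (- \<theta>) - 1) * (real n - 1)) - (- \<theta> * (c * ln (real n)))) = (- \<delta> + (p\<^sub>0 - c) / n) * ln (real n)"
      unfolding p_def \<theta>(2) \<delta>_def \<theta>_def[symmetric] using elim p\<^sub>0 by (simp add: field_simps)
    finally show ?case .
  qed
  have "\<delta> > 0" using c by (simp add: \<delta>_def)
  then show "?b \<longlonglongrightarrow> 0" by real_asymp
qed

lemma edge_count:
  assumes \<eta>: "\<eta> > 0"
  shows "(\<lambda>n. measure_pmf.prob (erdos_renyi n (p n)) {E. (1 + \<eta>) * p\<^sub>0 * ln (real n) * real n / 2 \<le> real (card E)}) \<longlonglongrightarrow> 0"
proof (rule prob_tendsto_0)
  \<comment> \<open>So small that \<open>e\<^sup>\<theta> - 1 \<le> \<theta> + \<theta>\<^sup>2 < \<theta> (1 + \<eta>)\<close>.\<close>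
  define \<theta> where "\<theta> = min 1 (\<eta> / 2)"
  have \<theta>: "0 < \<theta>" "\<theta> \<le> 1" "\<theta> < \<eta>" using \<eta> by (auto simp: \<theta>_def)
  define \<delta> where "\<delta> = \<theta> * (1 + \<eta>) - (exp \<theta> - 1)"
  have "exp \<theta> \<le> 1 + \<theta> + \<theta>\<^sup>2" using \<theta> by (intro exp_bound) auto
  also have "\<theta>\<^sup>2 < \<theta> * \<eta>" using \<theta> by (simp add: power2_eq_square)
  finally have \<delta>: "\<delta> > 0" by (simp add: \<delta>_def algebra_simps)
  let ?b = "\<lambda>n. exp (- \<delta> * (p\<^sub>0 * ln (real n) * real n / 2))"
  show "eventually (\<lambda>n. measure_pmf.prob (erdos_renyi n (p n)) {E. (1 + \<eta>) * p\<^sub>0 * ln (real n) * real n / 2 \<le> real (card E)} \<le> ?b n) sequentially"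
    using eventually_p eventually_gt_at_top[of 0]
  proof eventually_elim
    case (elim n)
    let ?a = "(1 + \<eta>) * p\<^sub>0 * ln (real n) * n / 2"
    have eq: "{E. ?a \<le> real (card E)} = {E. \<theta> * ?a \<le> (\<Sum>e\<in>E. \<theta>)}" using \<theta> by (auto simp: mult.commute)
    have "measure_pmf.prob (erdos_renyi n (p n)) {E. ?a \<le> real (card E)} \<le>
        exp (p n * (\<Sum>e\<in>vertex_pairs n. exp \<theta> - 1) - \<theta> * ?a)"
      unfolding eq by (rule erdos_renyi_chernoff) (use elim in auto)
    also have "p n * (\<Sum>e\<in>vertex_pairs n. exp \<theta> - 1) \<le> p n * (real n * real n / 2 * (exp \<theta> - 1))"
    proof -
      have "2 * card (vertex_pairs n) \<le> n * n" unfolding card_vertex_pairs by (intro mult_le_mono) auto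
      then have "2 * real (card (vertex_pairs n)) \<le> real n * real n" 
        by (metis of_nat_le_iff of_nat_mult of_nat_numeral)
      then have "(\<Sum>e\<in>vertex_pairs n. exp \<theta> - 1) \<le> real n * real n / 2 * (exp \<theta> - 1)"
        unfolding sum_constant using \<theta> by (intro mult_right_mono) auto
      then show ?thesis using elim by (intro mult_left_mono) auto
    qed
    also have "p n * (real n * real n / 2 * (exp \<theta> - 1)) - \<theta> * ?a = - \<delta> * (p\<^sub>0 * ln (real n) * n / 2)"
      using elim by (simp add: p_def \<delta>_def field_simps)
    finally show ?case by simp
  qed
  show "?b \<longlonglongrightarrow> 0" using \<delta> p\<^sub>0 by real_asymp
qed

end

section \<open>Discrepancy of the random graph\<close>

text \<open>Each edge is one independent coin, but it occupies two matrix entries; with these weights, a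
  sum of entries over a rectangle becomes a sum over edges. The weight is \<open>2\<close> inside \<open>S \<inter> T\<close>.\<close>

definition pair_weight :: "nat set \<Rightarrow> nat set \<Rightarrow> nat set \<Rightarrow> real" where
  "pair_weight S T e = (\<Sum>u\<in>S. \<Sum>v\<in>T. of_bool ({u, v} = e))"

lemma sum_pair_weight:
  assumes "S \<subseteq> {..<n}" "T \<subseteq> {..<n}"
  shows "(\<Sum>e\<in>vertex_pairs n. pair_weight S T e * f e) = (\<Sum>u\<in>S. \<Sum>v\<in>T. if u = v then 0 else f {u, v})"
proof -
  have "(\<Sum>e\<in>vertex_pairs n. pair_weight S T e * f e) =
      (\<Sum>e\<in>vertex_pairs n. \<Sum>u\<in>S. \<Sum>v\<in>T. if {u, v} = e then f e else 0)"
    unfolding pair_weight_def sum_distrib_right by (intro sum.cong refl) auto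
  also have "\<dots> = (\<Sum>u\<in>S. \<Sum>e\<in>vertex_pairs n. \<Sum>v\<in>T. if {u, v} = e then f e else 0)"
    by (rule sum.swap)
  also have "\<dots> = (\<Sum>u\<in>S. \<Sum>v\<in>T. \<Sum>e\<in>vertex_pairs n. if {u, v} = e then f e else 0)"
    by (intro sum.cong refl sum.swap)
  also have "\<dots> = (\<Sum>u\<in>S. \<Sum>v\<in>T. if u = v then 0 else f {u, v})"
  proof (intro sum.cong refl)
    fix u v assume "u \<in> S" "v \<in> T"
    then have "{u, v} \<in> vertex_pairs n \<longleftrightarrow> u \<noteq> v"
      using assms by (auto simp: vertex_pairs_def card_2_iff')
    then show "(\<Sum>e\<in>vertex_pairs n. if {u, v} = e then f e else 0) = (if u = v then 0 else f {u, v})"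
      by (simp add: sum.delta' )
  qed
  finally show ?thesis .
qed

lemma sum_centred:
  assumes E: "E \<subseteq> vertex_pairs n" and ST: "S \<subseteq> {..<n}" "T \<subseteq> {..<n}"
  shows "(\<Sum>u\<in>S. \<Sum>v\<in>T. centred p E u v) =
    (\<Sum>e\<in>E. pair_weight S T e) - p * (\<Sum>e\<in>vertex_pairs n. pair_weight S T e)"
proof -
  have "(\<Sum>u\<in>S. \<Sum>v\<in>T. centred p E u v) = (\<Sum>e\<in>vertex_pairs n. pair_weight S T e * (of_bool (e \<in> E) - p))"
    unfolding sum_pair_weight[OF ST] centred_def adj_def ..
  also have "\<dots> = (\<Sum>e\<in>vertex_pairs n. pair_weight S T e * of_bool (e \<in> E)) - p * (\<Sum>e\<in>vertex_pairs n. pair_weight S T e)"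
    by (simp add: right_diff_distrib sum_subtractf sum_distrib_left mult.commute)
  also have "(\<Sum>e\<in>vertex_pairs n. pair_weight S T e * of_bool (e \<in> E)) = (\<Sum>e\<in>E. pair_weight S T e)"
    using E by (intro sum.mono_neutral_cong_right) auto
  finally show ?thesis .
qed

lemma pair_weight_range:
  assumes fin: "finite S" "finite T" and e: "e \<in> vertex_pairs n"
  shows "0 \<le> pair_weight S T e \<and> pair_weight S T e \<le> 2"
proof
  show "0 \<le> pair_weight S T e" unfolding pair_weight_def by (intro sum_nonneg) auto
  obtain a b where ab: "e = {a, b}" using e by (auto simp: vertex_pairs_def card_2_iff)
  have one: "(\<Sum>u\<in>S. \<Sum>v\<in>T. of_bool (u = x) * of_bool (v = y)) \<le> (1 :: real)" for x y
  proof -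
    have le: "(\<Sum>u\<in>A. of_bool (u = z)) \<le> (1 :: real)" if "finite A" for A and z :: nat
      using that by (simp only: of_bool_def sum.delta) auto
    have "(\<Sum>u\<in>S. \<Sum>v\<in>T. of_bool (u = x) * of_bool (v = y)) =
        (\<Sum>u\<in>S. of_bool (u = x)) * (\<Sum>v\<in>T. of_bool (v = y) :: real)"
      by (rule sum_product[symmetric])
    also have "\<dots> \<le> 1" using le[OF fin(1), of x] le[OF fin(2), of y]
      by (intro mult_le_one) (auto intro: sum_nonneg)
    finally show ?thesis .
  qed
  have "pair_weight S T e \<le> (\<Sum>u\<in>S. \<Sum>v\<in>T. of_bool (u = a) * of_bool (v = b) + of_bool (u = b) * of_bool (v = a))"
    unfolding pair_weight_def ab doubleton_eq_iff by (intro sum_mono) (simp add: of_bool_def)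
  also have "\<dots> \<le> 2" unfolding sum.distrib using one[of a b] one[of b a] by linarith
  finally show "pair_weight S T e \<le> 2" .
qed

lemma sum_pair_weight_le:
  assumes "S \<subseteq> {..<n}" "T \<subseteq> {..<n}"
  shows "(\<Sum>e\<in>vertex_pairs n. pair_weight S T e) \<le> card S * card T"
proof -
  have "(\<Sum>e\<in>vertex_pairs n. pair_weight S T e) = (\<Sum>u\<in>S. \<Sum>v\<in>T. if u = v then 0 else 1)"
    using sum_pair_weight[OF assms, of "\<lambda>_. 1"] by simp
  also have "\<dots> \<le> (\<Sum>u\<in>S. \<Sum>v\<in>T. 1)" by (intro sum_mono) auto
  finally show ?thesis by simp
qed

definition exp_excess :: "real \<Rightarrow> real" where
  "exp_excess x = exp x - 1 - x"

lemma exp_excess_nonneg: "exp_excess x \<ge> 0"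
  using exp_ge_add_one_self[of x] unfolding exp_excess_def by linarith

lemma exp_excess_minus_le:
  assumes "x \<ge> 0"
  shows "exp_excess (- x) \<le> exp_excess x"
proof -
  have "x \<le> sinh x" if "x \<ge> 0" for x :: real
  proof -
    have "(\<lambda>y. sinh y - y) 0 \<le> (\<lambda>y. sinh y - y) x"
    proof (rule DERIV_nonneg_imp_nondecreasing[OF that])
      fix y :: real
      show "\<exists>z. ((\<lambda>y. sinh y - y) has_real_derivative z) (at y) \<and> 0 \<le> z"
        by (intro exI[of _ "cosh y - 1"]) (auto intro!: derivative_eq_intros simp: cosh_real_ge_1)
    qed
    then show ?thesis by simp
  qed
  from this[OF assms] show ?thesis by (simp add: exp_excess_def sinh_def field_simps)
qed

lemma exp_excess_scale_le:
  assumes "0 \<le> t" "t \<le> 1"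
  shows "exp_excess (t * x) \<le> t * exp_excess x"
proof -
  have "exp ((1 - t) * 0 + t * x) \<le> (1 - t) * exp 0 + t * exp x"
    using convex_onD[OF exp_convex, of t 0 x] assms by simp
  then show ?thesis by (simp add: exp_excess_def algebra_simps)
qed

text \<open>Both tails are bounded with the parameter \<open>\<theta>\<close>; convexity of the exponential reduces the weights,
  which lie in \<open>[0, 2]\<close>, to the extreme weight \<open>2\<close>.\<close>

lemma prob_discrepancy:
  fixes p \<theta> a :: real
  assumes p: "0 \<le> p" "p \<le> 1" and ST: "S \<subseteq> {..<n}" "T \<subseteq> {..<n}" and \<theta>: "\<theta> \<ge> 0"
  shows "measure_pmf.prob (erdos_renyi n p) {E. a \<le> \<bar>\<Sum>u\<in>S. \<Sum>v\<in>T. centred p E u v\<bar>}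
     \<le> 2 * exp (p * (card S * card T) * exp_excess (2 * \<theta>) / 2 - \<theta> * a)"
proof -
  let ?VP = "vertex_pairs n" and ?w = "pair_weight S T"
  have fin: "finite S" "finite T" using ST finite_subset by blast+
  define W where "W = (\<Sum>e\<in>?VP. ?w e)"
  define B where "B = exp (p * (card S * card T) * exp_excess (2 * \<theta>) / 2 - \<theta> * a)"
  have main: "measure_pmf.prob (erdos_renyi n p) {E. \<theta> * a \<le> \<sigma> * \<theta> * (\<Sum>u\<in>S. \<Sum>v\<in>T. centred p E u v)} \<le> B"
    if \<sigma>: "\<sigma> = 1 \<or> \<sigma> = -1" for \<sigma> :: real
  proof -
    have "measure_pmf.prob (erdos_renyi n p) {E. \<theta> * a \<le> \<sigma> * \<theta> * (\<Sum>u\<in>S. \<Sum>v\<in>T. centred p E u v)} \<le>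
        measure_pmf.prob (erdos_renyi n p) {E. \<theta> * a + \<sigma> * \<theta> * (p * W) \<le> (\<Sum>e\<in>E. \<sigma> * \<theta> * ?w e)}"
    proof (rule prob_erdos_renyi_mono)
      fix E assume "E \<subseteq> ?VP" "\<theta> * a \<le> \<sigma> * \<theta> * (\<Sum>u\<in>S. \<Sum>v\<in>T. centred p E u v)"
      then show "\<theta> * a + \<sigma> * \<theta> * (p * W) \<le> (\<Sum>e\<in>E. \<sigma> * \<theta> * ?w e)"
        by (simp add: sum_centred[OF _ ST] W_def right_diff_distrib sum_distrib_left[symmetric])
    qed
    also have "\<dots> \<le> exp (p * (\<Sum>e\<in>?VP. exp (\<sigma> * \<theta> * ?w e) - 1) - (\<theta> * a + \<sigma> * \<theta> * (p * W)))"
      by (rule erdos_renyi_chernoff[OF p])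
    also have "p * (\<Sum>e\<in>?VP. exp (\<sigma> * \<theta> * ?w e) - 1) - (\<theta> * a + \<sigma> * \<theta> * (p * W)) =
        p * (\<Sum>e\<in>?VP. exp_excess (\<sigma> * \<theta> * ?w e)) - \<theta> * a"
      by (simp add: exp_excess_def W_def sum_subtractf sum_distrib_left algebra_simps)
    also have "(\<Sum>e\<in>?VP. exp_excess (\<sigma> * \<theta> * ?w e)) \<le> (\<Sum>e\<in>?VP. ?w e * (exp_excess (2 * \<theta>) / 2))"
    proof (rule sum_mono)
      fix e assume "e \<in> ?VP"
      then have w: "0 \<le> ?w e" "?w e \<le> 2" using pair_weight_range[OF fin] by auto
      have "exp_excess (\<sigma> * \<theta> * ?w e) \<le> exp_excess (\<theta> * ?w e)"
        using \<sigma> exp_excess_minus_le[of "\<theta> * ?w e"] \<theta> w by auto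
      also have "\<dots> = exp_excess (?w e / 2 * (2 * \<theta>))" by (simp add: mult.commute)
      also have "\<dots> \<le> ?w e / 2 * exp_excess (2 * \<theta>)" using w by (intro exp_excess_scale_le) auto
      finally show "exp_excess (\<sigma> * \<theta> * ?w e) \<le> ?w e * (exp_excess (2 * \<theta>) / 2)" by simp
    qed
    also have "\<dots> \<le> (card S * card T) * (exp_excess (2 * \<theta>) / 2)"
      unfolding sum_distrib_right[symmetric]
      using sum_pair_weight_le[OF ST] exp_excess_nonneg by (intro mult_right_mono) auto
    finally show ?thesis using p by (simp add: B_def mult_left_mono mult.assoc)
  qed
  have "measure_pmf.prob (erdos_renyi n p) {E. a \<le> \<bar>\<Sum>u\<in>S. \<Sum>v\<in>T. centred p E u v\<bar>} \<le>
    measure_pmf.prob (erdos_renyi n p) {E. \<exists>\<sigma>\<in>{1,-1}. \<theta> * a \<le> \<sigma> * \<theta> * (\<Sum>u\<in>S. \<Sum>v\<in>T. centred p E u v)}"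
  proof (rule prob_erdos_renyi_mono)
    fix E assume *: "a \<le> \<bar>\<Sum>u\<in>S. \<Sum>v\<in>T. centred p E u v\<bar>"
    let ?X = "\<Sum>u\<in>S. \<Sum>v\<in>T. centred p E u v"
    show "\<exists>\<sigma>\<in>{1,-1}. \<theta> * a \<le> \<sigma> * \<theta> * ?X"
      using mult_left_mono[OF *, of \<theta>] \<theta> by (cases "?X \<ge> 0") auto
  qed
  also have "\<dots> \<le> (\<Sum>\<sigma>\<in>{1,-1::real}. B)"
    by (rule prob_erdos_renyi_union_bound) (auto intro: main[of 1, simplified] main[of "-1", simplified])
  finally show ?thesis by (simp add: B_def)
qed

text \<open>Weight a subset by \<open>(t/n)\<close> to its cardinality; the total weight is \<open>(1 + t/n)\<^sup>n \<le> e\<^sup>t\<close>.\<close>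

lemma card_small_subsets_le:
  fixes t n :: nat
  assumes t: "1 \<le> t" "t \<le> n"
  shows "card {S. S \<subseteq> {..<n} \<and> card S \<le> t} \<le> exp (real t * (1 + ln (real n / real t)))"
proof -
  define x where "x = real t / real n"
  have x: "0 < x" "x \<le> 1" using t by (auto simp: x_def)
  have fin: "finite {S. S \<subseteq> {..<n} \<and> card S \<le> t}" by (rule finite_subset[of _ "Pow {..<n}"]) auto
  have "card {S. S \<subseteq> {..<n} \<and> card S \<le> t} * x ^ t = (\<Sum>S | S \<subseteq> {..<n} \<and> card S \<le> t. x ^ t)" by simp
  also have "\<dots> \<le> (\<Sum>S | S \<subseteq> {..<n} \<and> card S \<le> t. x ^ card S)"
    using x by (intro sum_mono power_decreasing) auto
  also have "\<dots> \<le> (\<Sum>S\<in>Pow {..<n}. x ^ card S)"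
    using x by (intro sum_mono2) auto
  also have "\<dots> = (\<Prod>i<n. x + 1)" by (subst prod_add) auto
  also have "\<dots> \<le> exp x ^ n" using x exp_ge_add_one_self[of x] by (simp add: power_mono add.commute)
  also have "\<dots> = exp t" using t by (simp add: x_def flip: exp_of_nat_mult)
  finally have "card {S. S \<subseteq> {..<n} \<and> card S \<le> t} \<le> exp t / x ^ t" using x by (simp add: pos_le_divide_eq)
  also have "x ^ t = exp (t * ln x)" using x by (simp add: exp_of_nat_mult)
  also have "exp t / exp (t * ln x) = exp (real t * (1 + ln (real n / real t)))"
    using t by (simp add: x_def ln_div algebra_simps flip: exp_diff)
  finally show ?thesis .
qed

text \<open>For \<open>t \<le> n\<^bsup>1-\<delta>\<^esup>\<close> the first term in the minimum beats the crude count \<open>n\<^bsup>2t\<^esup>\<close> of pairs of sets;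
  for larger \<open>t\<close> the second does, as the count is then only \<open>e\<^bsup>2t(1 + \<delta> ln n)\<^esup>\<close>.\<close>

lemma union_bound_exponent:
  fixes C c :: real
  assumes "C \<ge> 0" and c: "c > 0"
  shows "eventually (\<lambda>n. \<forall>t :: nat. 1 \<le> t \<and> t \<le> n \<longrightarrow>
      2 * real t * (1 + ln (real n / real t)) + min (C * ln (real n) * real t * real t / real n - 6 * real t * ln (real n)) (- c * real t * ln (real n)) \<le> - 2 * ln (real n)) (sequentially :: nat filter)"
proof -
  define \<delta> where "\<delta> = min (1/2) (c / 8)"
  have \<delta>: "\<delta> > 0" "\<delta> \<le> 1/2" "\<delta> \<le> c / 8" using c by (auto simp: \<delta>_def)
  have "eventually (\<lambda>n. 2 + C * ln (real n) * real n powr (- \<delta>) \<le> 2 * ln (real n)) sequentially"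
    using \<delta> by real_asymp
  moreover have "eventually (\<lambda>n. 2 \<le> c / 2 * ln (real n)) sequentially" using c by real_asymp
  moreover have "eventually (\<lambda>n. 2 \<le> c / 4 * real n powr (1/2)) sequentially" using c by real_asymp
  ultimately show ?thesis using eventually_ge_at_top[of 3]
  proof eventually_elim
    case (elim n)
    define L where "L = ln (real n)"
    have "L > 0" using elim by (simp add: L_def)
    show ?case
    proof (intro allI impI)
      fix t assume t: "1 \<le> t \<and> t \<le> n"
      have lnt: "ln (real n / real t) = L - ln t" using t by (simp add: L_def ln_div)
      have "ln (real t) \<ge> 0" using t by simp
      show "2 * real t * (1 + ln (real n / real t)) + min (C * ln (real n) * real t * real t / real n - 6 * real t * ln (real n)) (- c * real t * ln (real n)) \<le> - 2 * ln (real n)"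
      proof (cases "real t \<le> real n powr (1 - \<delta>)")
        case True
        have "real t / n \<le> n powr (1 - \<delta>) / n" using True by (intro divide_right_mono) auto
        also have "\<dots> = n powr (- \<delta>)" using elim by (simp add: powr_diff powr_minus field_simps)
        finally have tn: "real t / n \<le> n powr (- \<delta>)" .
        have "C * L * real t * real t / real n = t * (C * L * (t / n))" by simp
        also have "\<dots> \<le> t * (C * L * n powr (- \<delta>))"
          using tn assms \<open>L > 0\<close> by (intro mult_left_mono) auto
        also have "\<dots> \<le> t * (2 * L - 2)" using elim by (intro mult_left_mono) (auto simp: L_def)
        finally have "C * L * real t * real t / real n \<le> t * (2 * L - 2)" .
        moreover have "2 * real t * (1 + ln (real n / real t)) \<le> 2 * real t * (1 + L)"
          using \<open>ln (real t) \<ge> 0\<close> unfolding lnt by (intro mult_left_mono) auto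
        moreover have "1 * L \<le> t * L" using t \<open>L > 0\<close> by (intro mult_right_mono) auto
        ultimately have "2 * real t * (1 + ln (real n / real t)) + (C * L * real t * real t / real n - 6 * real t * L) \<le> - 2 * L"
          by (simp add: algebra_simps)
        then show ?thesis unfolding L_def by linarith
      next
        case False
        have "n powr (1/2) \<le> n powr (1 - \<delta>)" using elim \<delta> by (intro powr_mono) auto
        then have "c / 4 * n powr (1/2) \<le> c / 4 * t" using False c by (intro mult_left_mono) auto
        then have ct: "2 \<le> c / 4 * t" using elim by linarith
        have "(1 - \<delta>) * L = ln (n powr (1 - \<delta>))" using elim by (simp add: L_def ln_powr)
        also have "\<dots> \<le> ln t" using False elim t by (subst ln_le_cancel_iff) auto
        finally have "ln (real n / real t) \<le> \<delta> * L" unfolding lnt by (simp add: algebra_simps)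
        also have "\<dots> \<le> c / 8 * L" using \<delta> \<open>L > 0\<close> by (intro mult_right_mono) auto
        finally have "2 * real t * (1 + ln (real n / real t)) \<le> 2 * real t * (1 + c / 8 * L)"
          by (intro mult_left_mono) auto
        moreover have "2 * real t \<le> c / 2 * L * t" using elim by (intro mult_right_mono) (auto simp: L_def)
        moreover have "2 * L \<le> c / 4 * t * L" using ct \<open>L > 0\<close> by (intro mult_right_mono) auto
        ultimately have "2 * real t * (1 + ln (real n / real t)) + (- c * t * L) \<le> - 2 * L"
          by (simp add: algebra_simps)
        then show ?thesis unfolding L_def by linarith
      qed
    qed
  qed
qed

lemma centred_commute: "centred p E u v = centred p E v u"
  by (simp add: centred_def adj_commute)

text \<open>A set \<open>S\<close> much smaller than \<open>T\<close> meets too few edges, by the row sums alone, to violate the bound;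
  so only pairs of comparable sizes have to be handled by probability. The matrix being symmetric, the
  smaller set may be taken first.\<close>

lemma balanced_violation:
  fixes p \<beta> \<Delta> :: real
  assumes E: "E \<subseteq> vertex_pairs n" and p: "p \<ge> 0" and "\<beta> > 0" "\<Delta> > 0"
    and row: "\<And>u. u < n \<Longrightarrow> deg E u + p * n \<le> \<Delta>"
    and ST: "S \<subseteq> {..<n}" "T \<subseteq> {..<n}" "\<beta> * sqrt (card S * card T) < \<bar>\<Sum>u\<in>S. \<Sum>v\<in>T. centred p E u v\<bar>"
  shows "\<exists>S T. S \<subseteq> {..<n} \<and> T \<subseteq> {..<n} \<and> 1 \<le> card T \<and> card S \<le> card T \<and>
      (\<beta> / \<Delta>)\<^sup>2 * card T \<le> card S \<and> \<beta> * sqrt (card S * card T) < \<bar>\<Sum>u\<in>S. \<Sum>v\<in>T. centred p E u v\<bar>"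
proof -
  obtain S' T' where ST': "S' \<subseteq> {..<n}" "T' \<subseteq> {..<n}" "card S' \<le> card T'"
      "\<beta> * sqrt (card S' * card T') < \<bar>\<Sum>u\<in>S'. \<Sum>v\<in>T'. centred p E u v\<bar>"
  proof (cases "card S \<le> card T")
    case True
    then show ?thesis using that ST by blast
  next
    case False
    have "(\<Sum>u\<in>S. \<Sum>v\<in>T. centred p E u v) = (\<Sum>v\<in>T. \<Sum>u\<in>S. centred p E v u)"
      by (subst sum.swap) (simp add: centred_commute[of p E])
    then show ?thesis using that[of T S] False ST by (simp add: mult.commute)
  qed
  have fin: "finite T'" using ST' finite_subset by blast
  have "T' \<noteq> {}" using ST'(4) by auto
  then have T1: "1 \<le> card T'" using fin by (simp add: Suc_le_eq card_gt_0_iff)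
  have "(\<beta> / \<Delta>)\<^sup>2 * card T' \<le> card S'"
  proof (rule ccontr)
    assume small: "\<not> (\<beta> / \<Delta>)\<^sup>2 * card T' \<le> card S'"
    have "\<bar>\<Sum>u\<in>S'. \<Sum>v\<in>T'. centred p E u v\<bar> \<le> (\<Sum>u\<in>S'. \<Sum>v\<in>T'. \<bar>centred p E u v\<bar>)"
      by (rule order.trans[OF sum_abs]) (intro sum_mono sum_abs)
    also have "\<dots> \<le> (\<Sum>u\<in>S'. \<Sum>v<n. \<bar>centred p E u v\<bar>)"
      using ST' by (intro sum_mono sum_mono2) auto
    also have "\<dots> \<le> (\<Sum>u\<in>S'. \<Delta>)"
    proof (rule sum_mono)
      fix u assume "u \<in> S'"
      then have "u < n" using ST' by auto
      then show "(\<Sum>v<n. \<bar>centred p E u v\<bar>) \<le> \<Delta>"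
        using centred_row_sum_le[OF E p, of u] row[of u] by linarith
    qed
    also have "\<dots> = \<Delta> * (sqrt (card S') * sqrt (card S'))" by simp
    also have "sqrt (card S') \<le> \<beta> / \<Delta> * sqrt (card T')"
    proof -
      have "sqrt (card S') \<le> sqrt ((\<beta> / \<Delta>)\<^sup>2 * card T')" using small by (intro real_sqrt_le_mono) auto
      then show ?thesis using assms by (simp add: real_sqrt_mult)
    qed
    then have "\<Delta> * (sqrt (card S') * sqrt (card S')) \<le> \<Delta> * (sqrt (card S') * (\<beta> / \<Delta> * sqrt (card T')))"
      using assms by (intro mult_left_mono) auto
    also have "\<dots> = \<beta> * sqrt (card S' * card T')" using assms by (simp add: real_sqrt_mult)
    finally show False using ST'(4) by simp
  qed
  then show ?thesis using ST' T1 by blast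
qed

context
  fixes p\<^sub>0 :: real and p :: "nat \<Rightarrow> real"
  assumes p\<^sub>0: "p\<^sub>0 > 0" and p_def: "\<And>n. p n = p\<^sub>0 * ln n / n"
begin

text \<open>The union bound runs over the size \<open>t\<close> of the larger set; \<open>card_small_subsets_le\<close> counts the pairs of
  sets, and \<open>union_bound_exponent\<close> says that one of two Chernoff parameters always outweighs the
  count.\<close>

lemma discrepancy:
  assumes K: "K > 0" and \<eta>: "\<eta> > 0"
  shows "(\<lambda>n. measure_pmf.prob (erdos_renyi n (p n))
      {E. (\<forall>u<n. deg E u \<le> K * ln (real n)) \<and> (\<exists>S T. S \<subseteq> {..<n} \<and> T \<subseteq> {..<n} \<and>
          \<eta> * ln (real n) * sqrt (card S * card T) < \<bar>\<Sum>u\<in>S. \<Sum>v\<in>T. centred (p n) E u v\<bar>)}) \<longlonglongrightarrow> 0"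
    (is "(\<lambda>n. measure_pmf.prob _ {E. ?bad n E}) \<longlonglongrightarrow> 0")
proof (rule prob_tendsto_0)
  define \<kappa> where "\<kappa> = \<eta> / (K + p\<^sub>0)"
  have \<kappa>: "\<kappa> > 0" using K \<eta> p\<^sub>0 by (simp add: \<kappa>_def)
  \<comment> \<open>Two Chernoff parameters. With \<open>a\<close> the gain is \<open>6 t ln n\<close>, at a cost that is negligible for \<open>t\<close> much
    smaller than \<open>n\<close>; with \<open>b\<close> the quadratic cost is at most half of the gain for all \<open>t\<close>.\<close>
  define a where "a = 6 / (\<eta> * \<kappa>)"
  define b where "b = min (1/2) (\<eta> / (4 * p\<^sub>0))"
  define C where "C = p\<^sub>0 * exp_excess (2 * a) / 2"
  define c where "c = b * \<eta> * \<kappa> / 2"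
  have a: "a > 0" using \<eta> \<kappa> by (simp add: a_def)
  have b: "b > 0" "b \<le> 1/2" "b \<le> \<eta> / (4 * p\<^sub>0)" using \<eta> p\<^sub>0 by (auto simp: b_def)
  have "C \<ge> 0" using p\<^sub>0 exp_excess_nonneg by (simp add: C_def)
  moreover have "c > 0" using b \<eta> \<kappa> by (simp add: c_def)
  ultimately have ev: "eventually (\<lambda>n. \<forall>t::nat. 1 \<le> t \<and> t \<le> n \<longrightarrow>
      2 * real t * (1 + ln (real n / real t)) + min (C * ln (real n) * real t * real t / real n - 6 * real t * ln (real n)) (- c * real t * ln (real n)) \<le> - 2 * ln (real n)) sequentially"
    by (rule union_bound_exponent)
  show "eventually (\<lambda>n. measure_pmf.prob (erdos_renyi n (p n)) {E. ?bad n E} \<le> 2 / n) sequentially"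
    using ev eventually_p[OF p\<^sub>0 p_def] eventually_ge_at_top[of 3]
  proof eventually_elim
    case (elim n)
    define L where "L = ln (real n)"
    have L: "L > 0" using elim by (simp add: L_def)
    have n: "n > 0" using elim by simp
    have pn: "p n * n = p\<^sub>0 * L" using n by (simp add: p_def L_def)
    define F where "F t = {S. S \<subseteq> {..<n} \<and> card S \<le> t}" for t
    define e where "e t = min (C * L * real t * real t / real n - 6 * real t * L) (- c * real t * L)" for t :: nat
    let ?X = "\<lambda>E S T. \<bar>\<Sum>u\<in>S. \<Sum>v\<in>T. centred (p n) E u v\<bar>"
    define viol where "viol t ST E = (case ST of (S, T) \<Rightarrow> card T = t \<and> \<kappa>\<^sup>2 * card T \<le> card S \<and>
        \<eta> * L * sqrt (card S * card T) < ?X E S T)" for t ST E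
    have finF: "finite (F t)" for t unfolding F_def by (rule finite_subset[of _ "Pow {..<n}"]) auto
    have single: "measure_pmf.prob (erdos_renyi n (p n)) {E. viol t ST E} \<le> 2 * exp (e t)"
      if t: "t \<in> {1..n}" and ST: "ST \<in> F t \<times> F t" for t ST
    proof -
      obtain S T where [simp]: "ST = (S, T)" by (cases ST)
      have sub: "S \<subseteq> {..<n}" "T \<subseteq> {..<n}" "card S \<le> t" using ST by (auto simp: F_def)
      show ?thesis
      proof (cases "card T = t \<and> \<kappa>\<^sup>2 * card T \<le> card S")
        case False
        then have "{E. viol t ST E} = {}" by (auto simp: viol_def)
        then show ?thesis by simp
      next
        case True
        define r where "r = sqrt (real (card S * card T))"
        have r2: "r * r = real (card S * card T)" by (simp add: r_def)
        have r0: "r \<ge> 0" by (simp add: r_def)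
        have "real (card S * card T) \<le> real t * real t" using sub True by (simp add: mult_mono)
        have rt: "r \<le> t" unfolding r_def using \<open>_ \<le> real t * real t\<close> by (intro real_le_lsqrt) (auto simp: power2_eq_square)
        have "\<kappa>\<^sup>2 * t \<le> card S" using True by metis
        from mult_right_mono[OF this, of "real t"] have "(\<kappa> * t)\<^sup>2 \<le> real (card S * card T)"
          using True by (simp add: power_mult_distrib power2_eq_square mult_ac)
        then have rk: "\<kappa> * t \<le> r" unfolding r_def by (intro real_le_rsqrt)
        have bound: "measure_pmf.prob (erdos_renyi n (p n)) {E. viol t ST E} \<le>
            2 * exp (p n * (r * r) * exp_excess (2 * \<theta>) / 2 - \<theta> * (\<eta> * L * r))" if "\<theta> \<ge> 0" for \<theta>
        proof -
          have "measure_pmf.prob (erdos_renyi n (p n)) {E. viol t ST E} \<le>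
              measure_pmf.prob (erdos_renyi n (p n)) {E. \<eta> * L * r \<le> ?X E S T}"
            by (rule prob_erdos_renyi_mono) (auto simp: viol_def r_def)
          also have "\<dots> \<le> 2 * exp (p n * (r * r) * exp_excess (2 * \<theta>) / 2 - \<theta> * (\<eta> * L * r))"
            unfolding r2 using elim sub that by (intro prob_discrepancy) auto
          finally show ?thesis .
        qed
        have cost_a: "p n * (r * r) * exp_excess (2 * a) / 2 - a * (\<eta> * L * r) \<le> C * L * t * t / n - 6 * t * L"
        proof -
          have "p n * (r * r) * exp_excess (2 * a) / 2 \<le> p n * (real t * real t) * exp_excess (2 * a) / 2"
            using elim rt r0 exp_excess_nonneg by (intro divide_right_mono mult_right_mono mult_left_mono mult_mono) auto
          also have "\<dots> = C * L * t * t / n" by (simp add: p_def C_def L_def mult_ac)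
          finally have 1: "p n * (r * r) * exp_excess (2 * a) / 2 \<le> C * L * t * t / n" .
          have "6 * t * L = a * (\<eta> * L * (\<kappa> * t))" using \<eta> \<kappa> by (simp add: a_def)
          also have "\<dots> \<le> a * (\<eta> * L * r)" using rk a \<eta> L by (intro mult_left_mono) auto
          finally show ?thesis using 1 by linarith
        qed
        have cost_b: "p n * (r * r) * exp_excess (2 * b) / 2 - b * (\<eta> * L * r) \<le> - c * t * L"
        proof -
          have "exp_excess (2 * b) \<le> (2 * b)\<^sup>2"
            using exp_bound[of "2 * b"] b by (simp add: exp_excess_def)
          then have "p n * (r * r) * exp_excess (2 * b) / 2 \<le> p n * (r * n) * (2 * b)\<^sup>2 / 2"
            using elim rt r0 t exp_excess_nonneg
            by (intro divide_right_mono mult_mono mult_left_mono) auto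
          also have "\<dots> = (p n * n) * (r * (2 * b * b))" by (simp add: power2_eq_square)
          also have "\<dots> = L * r * b * 2 * (p\<^sub>0 * b)" unfolding pn by simp
          also have "\<dots> \<le> L * r * b * 2 * (\<eta> / 4)"
            using b L r0 p\<^sub>0 by (intro mult_left_mono) (auto simp: field_simps)
          finally have 1: "p n * (r * r) * exp_excess (2 * b) / 2 \<le> b * (\<eta> * L * r) / 2" by (simp add: mult_ac)
          have "c * t * L = b * (\<eta> * L * (\<kappa> * t)) / 2" by (simp add: c_def)
          also have "\<dots> \<le> b * (\<eta> * L * r) / 2" using rk b \<eta> L by (intro divide_right_mono mult_left_mono) auto
          finally show ?thesis using 1 by linarith
        qed
        have "measure_pmf.prob (erdos_renyi n (p n)) {E. viol t ST E} \<le> 2 * exp (C * L * t * t / n - 6 * t * L)"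
          by (rule order.trans[OF bound[of a]]) (use a cost_a in auto)
        moreover have "measure_pmf.prob (erdos_renyi n (p n)) {E. viol t ST E} \<le> 2 * exp (- c * t * L)"
          by (rule order.trans[OF bound[of b]]) (use b cost_b in auto)
        ultimately show ?thesis by (simp add: e_def min_def)
      qed
    qed
    have "measure_pmf.prob (erdos_renyi n (p n)) {E. ?bad n E} \<le>
        measure_pmf.prob (erdos_renyi n (p n)) {E. \<exists>t\<in>{1..n}. \<exists>ST\<in>F t \<times> F t. viol t ST E}"
    proof (rule prob_erdos_renyi_mono)
      fix E assume E: "E \<subseteq> vertex_pairs n" and bad: "?bad n E"
      then obtain S T where ST: "S \<subseteq> {..<n}" "T \<subseteq> {..<n}" "\<eta> * L * sqrt (card S * card T) < ?X E S T"
        unfolding L_def by blast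
      have deg: "deg E u + p n * n \<le> (K + p\<^sub>0) * L" if "u < n" for u
        using bad that unfolding pn by (simp add: L_def distrib_right)
      have \<kappa>_eq: "\<eta> * L / ((K + p\<^sub>0) * L) = \<kappa>" using L by (simp add: \<kappa>_def)
      have "\<exists>S T. S \<subseteq> {..<n} \<and> T \<subseteq> {..<n} \<and> 1 \<le> card T \<and> card S \<le> card T \<and>
          \<kappa>\<^sup>2 * card T \<le> card S \<and> \<eta> * L * sqrt (card S * card T) < ?X E S T"
        using balanced_violation[OF E _ _ _ deg ST] elim \<eta> L K p\<^sub>0 unfolding \<kappa>_eq by simp
      then obtain S T where ST: "S \<subseteq> {..<n}" "T \<subseteq> {..<n}" "1 \<le> card T" "card S \<le> card T"
        "\<kappa>\<^sup>2 * card T \<le> card S" "\<eta> * L * sqrt (card S * card T) < ?X E S T" by blast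
      have "card T \<le> n" using card_mono[OF _ ST(2)] by simp
      then show "\<exists>t\<in>{1..n}. \<exists>ST\<in>F t \<times> F t. viol t ST E"
        using ST by (intro bexI[of _ "card T"] bexI[of _ "(S, T)"]) (auto simp: F_def viol_def)
    qed
    also have "\<dots> \<le> (\<Sum>t\<in>{1..n}. 2 / (real n)\<^sup>2)"
    proof (rule prob_erdos_renyi_union_bound)
      fix t assume t: "t \<in> {1..n}"
      have "measure_pmf.prob (erdos_renyi n (p n)) {E. \<exists>ST\<in>F t \<times> F t. viol t ST E} \<le> (\<Sum>ST\<in>F t \<times> F t. 2 * exp (e t))"
        using finF single[OF t] by (intro prob_erdos_renyi_union_bound) auto
      also have "\<dots> = real (card (F t)) * real (card (F t)) * (2 * exp (e t))" by (simp add: card_cartesian_product)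
      also have "\<dots> \<le> exp (t * (1 + ln (n / t))) * exp (t * (1 + ln (n / t))) * (2 * exp (e t))"
        using t card_small_subsets_le[of t n] unfolding F_def by (intro mult_right_mono mult_mono) auto
      also have "\<dots> = 2 * exp (real t * (1 + ln (real n / real t)) + real t * (1 + ln (real n / real t)) + e t)"
        unfolding exp_add by (simp only: mult_ac)
      also have "real t * (1 + ln (real n / real t)) + real t * (1 + ln (real n / real t)) + e t =
          2 * real t * (1 + ln (real n / real t)) + e t" by simp
      also have "2 * exp (2 * real t * (1 + ln (real n / real t)) + e t) \<le> 2 * exp (- 2 * ln (real n))"
        using elim(1) t by (simp add: e_def L_def)
      also have "\<dots> = 2 / (real n)\<^sup>2" using n by (simp add: exp_minus exp_double divide_inverse)
      finally show "measure_pmf.prob (erdos_renyi n (p n)) {E. \<exists>ST\<in>F t \<times> F t. viol t ST E} \<le> 2 / (real n)\<^sup>2" .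
    qed simp
    also have "\<dots> = 2 / n" using n by (simp add: power2_eq_square)
    finally show ?case .
  qed
qed real_asymp

end

section \<open>The two regimes of the entropy\<close>

lemma prob_tendsto_1:
  assumes "eventually (\<lambda>n. \<forall>E. E \<subseteq> vertex_pairs n \<longrightarrow> \<not> Q n E \<longrightarrow> P n E) sequentially"
    and "(\<lambda>n. measure_pmf.prob (erdos_renyi n (p n)) {E. Q n E}) \<longlonglongrightarrow> 0"
  shows "(\<lambda>n. measure_pmf.prob (erdos_renyi n (p n)) {E. P n E}) \<longlonglongrightarrow> 1"
proof (rule tendsto_sandwich)
  show "eventually (\<lambda>n. 1 - measure_pmf.prob (erdos_renyi n (p n)) {E. Q n E} \<le>
      measure_pmf.prob (erdos_renyi n (p n)) {E. P n E}) sequentially"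
    using assms(1)
  proof eventually_elim
    case (elim n)
    have "1 - measure_pmf.prob (erdos_renyi n (p n)) {E. Q n E} = measure_pmf.prob (erdos_renyi n (p n)) {E. \<not> Q n E}"
      using measure_pmf.prob_compl[of "{E. Q n E}" "erdos_renyi n (p n)"] by (simp add: Collect_neg_eq Compl_eq_Diff_UNIV)
    also have "\<dots> \<le> measure_pmf.prob (erdos_renyi n (p n)) {E. P n E}"
      by (rule prob_erdos_renyi_mono) (use elim in auto)
    finally show ?case .
  qed
  show "(\<lambda>n. 1 - measure_pmf.prob (erdos_renyi n (p n)) {E. Q n E}) \<longlonglongrightarrow> 1"
    using tendsto_diff[OF tendsto_const[of 1] assms(2)] by simp
qed auto

lemma prob_disj_tendsto_0:
  assumes "(\<lambda>n. measure_pmf.prob (M n) {E. P n E}) \<longlonglongrightarrow> 0" "(\<lambda>n. measure_pmf.prob (M n) {E. Q n E}) \<longlonglongrightarrow> 0"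
  shows "(\<lambda>n. measure_pmf.prob (M n) {E. P n E \<or> Q n E}) \<longlonglongrightarrow> 0"
proof (rule prob_tendsto_0)
  have "measure_pmf.prob (M n) {E. P n E \<or> Q n E} \<le> measure_pmf.prob (M n) {E. P n E} + measure_pmf.prob (M n) {E. Q n E}" for n
    using measure_Un_le[of "{E. P n E}" "measure_pmf (M n)" "{E. Q n E}"] by (simp add: Collect_disj_eq)
  then show "eventually (\<lambda>n. measure_pmf.prob (M n) {E. P n E \<or> Q n E} \<le>
      measure_pmf.prob (M n) {E. P n E} + measure_pmf.prob (M n) {E. Q n E}) sequentially" by simp
  show "(\<lambda>n. measure_pmf.prob (M n) {E. P n E} + measure_pmf.prob (M n) {E. Q n E}) \<longlonglongrightarrow> 0"
    using tendsto_add[OF assms] by simp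
qed

context
  fixes p\<^sub>0 \<tau> :: real and p :: "nat \<Rightarrow> real"
  assumes p\<^sub>0: "p\<^sub>0 > 1" and \<tau>: "\<tau> > 0" and p_def: "\<And>n. p n = p\<^sub>0 * ln n / n"
begin

lemma entropy_high_temperature:
  assumes "\<tau> * p\<^sub>0 < 1"
  shows "\<exists>C. 0 < C \<and> C < 1 \<and> (\<lambda>n. measure_pmf.prob (erdos_renyi n (p n))
           {E. von_neumann_entropy (gibbs_state \<tau> (laplacian_mat n E)) \<ge> C * ln (real n)}) \<longlonglongrightarrow> 1"
proof (intro exI conjI)
  define C where "C = (1 - \<tau> * p\<^sub>0) / 2"
  define \<eta> where "\<eta> = C / (\<tau> * p\<^sub>0)"
  have tp: "\<tau> * p\<^sub>0 > 0" using p\<^sub>0 \<tau> by simp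
  show C: "0 < C" "C < 1" using assms tp by (auto simp: C_def)
  then have \<eta>: "\<eta> > 0" using tp by (simp add: \<eta>_def)
  have "\<tau> * p\<^sub>0 * \<eta> = C" using p\<^sub>0 \<tau> by (simp add: \<eta>_def)
  moreover have "\<tau> * ((1 + \<eta>) * p\<^sub>0) = \<tau> * p\<^sub>0 + \<tau> * p\<^sub>0 * \<eta>" by (simp add: algebra_simps)
  ultimately have t\<eta>: "\<tau> * ((1 + \<eta>) * p\<^sub>0) = 1 - C" by (simp add: C_def field_simps)
  have p\<^sub>0': "p\<^sub>0 > 0" using p\<^sub>0 by simp
  show "(\<lambda>n. measure_pmf.prob (erdos_renyi n (p n))
           {E. von_neumann_entropy (gibbs_state \<tau> (laplacian_mat n E)) \<ge> C * ln (real n)}) \<longlonglongrightarrow> 1"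
  proof (rule prob_tendsto_1[OF _ edge_count[OF p\<^sub>0' p_def \<eta>]])
    show "eventually (\<lambda>n. \<forall>E. E \<subseteq> vertex_pairs n \<longrightarrow> \<not> (1 + \<eta>) * p\<^sub>0 * ln (real n) * real n / 2 \<le> real (card E) \<longrightarrow>
        C * ln (real n) \<le> von_neumann_entropy (gibbs_state \<tau> (laplacian_mat n E))) sequentially"
      using eventually_gt_at_top[of 0]
    proof eventually_elim
      case (elim n)
      show ?case
      proof (intro allI impI)
        fix E assume E: "E \<subseteq> vertex_pairs n" "\<not> (1 + \<eta>) * p\<^sub>0 * ln (real n) * real n / 2 \<le> real (card E)"
        have "\<tau> * (2 * real (card E)) / n \<le> \<tau> * ((1 + \<eta>) * p\<^sub>0 * ln n * n) / n"
          using E(2) \<tau> elim by (intro divide_right_mono mult_left_mono) auto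
        also have "\<dots> = (\<tau> * ((1 + \<eta>) * p\<^sub>0)) * ln n" using elim by simp
        also have "\<dots> = ln n - C * ln n" unfolding t\<eta> by (simp add: algebra_simps)
        finally show "C * ln (real n) \<le> von_neumann_entropy (gibbs_state \<tau> (laplacian_mat n E))"
          using laplacian_entropy_ge[OF E(1) elim, of \<tau>] \<tau> by simp
      qed
    qed
  qed
qed

lemma entropy_low_temperature:
  assumes c: "0 < c" "c < p\<^sub>0" "\<tau> * c > 1" "1 + c * ln (p\<^sub>0 / c) - p\<^sub>0 + c < 0"
  shows "\<exists>\<epsilon>. \<epsilon> \<longlonglongrightarrow> 0 \<and> (\<lambda>n. measure_pmf.prob (erdos_renyi n (p n))
           {E. \<bar>von_neumann_entropy (gibbs_state \<tau> (laplacian_mat n E))\<bar> \<le> \<epsilon> n}) \<longlonglongrightarrow> 1"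
proof (intro exI conjI)
  have p\<^sub>0': "p\<^sub>0 > 0" using p\<^sub>0 by simp
  \<comment> \<open>The room between \<open>1/\<tau>\<close> and \<open>c\<close> leaves a slack \<open>s\<close> for the adjacency form: one half pays for the
    term with \<open>2\<^bsup>-\<gamma>\<^esup>\<close>, by the choice of \<open>\<gamma>\<close>, the other for the discrepancy, by the choice of \<open>\<eta>\<close>.\<close>
  define g where "g = (1 / \<tau> + c) / 2"
  have "1 / \<tau> < c" using c \<tau> by (simp add: field_simps)
  then have g: "1 / \<tau> < g" "g < c" by (auto simp: g_def)
  define q where "q = \<tau> * g"
  have q: "q > 1" using g \<tau> by (simp add: q_def field_simps)
  define s where "s = c - g"
  have s: "s > 0" using g by (simp add: s_def)
  obtain K where K: "K > 0" and
    maxdeg: "(\<lambda>n. measure_pmf.prob (erdos_renyi n (p n)) {E. \<exists>u\<in>{..<n}. K * ln (real n) \<le> real (deg E u)}) \<longlonglongrightarrow> 0"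
    using max_degree[OF p\<^sub>0' p_def] by blast
  obtain \<gamma> where "8 * (K + p\<^sub>0) / s < 2 ^ \<gamma>" using real_arch_pow[of 2 "8 * (K + p\<^sub>0) / s"] by auto
  then have \<gamma>: "4 * (K + p\<^sub>0) / 2 ^ \<gamma> \<le> s / 2" using s by (simp add: field_simps)
  define \<eta> where "\<eta> = s / (4 * (2 * real \<gamma> + 1))"
  have \<eta>: "\<eta> > 0" using s by (simp add: \<eta>_def)
  have "2 * (2 * real \<gamma> + 1) > 0" by simp
  then have \<eta>2: "2 * \<eta> * (2 * real \<gamma> + 1) = s / 2" by (simp add: \<eta>_def divide_simps)
  let ?\<epsilon> = "\<lambda>n. real n * exp (- q * ln (real n)) * (1 + q * ln (real n))"
  let ?bad = "\<lambda>n E. ((\<exists>u\<in>{..<n}. real (deg E u) \<le> c * ln (real n)) \<or> (\<exists>u\<in>{..<n}. K * ln (real n) \<le> real (deg E u))) \<or>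
      ((\<forall>u<n. deg E u \<le> K * ln (real n)) \<and> (\<exists>S T. S \<subseteq> {..<n} \<and> T \<subseteq> {..<n} \<and>
          \<eta> * ln (real n) * sqrt (card S * card T) < \<bar>\<Sum>u\<in>S. \<Sum>v\<in>T. centred (p n) E u v\<bar>))"
  show "?\<epsilon> \<longlonglongrightarrow> 0" using q by real_asymp
  have bad0: "(\<lambda>n. measure_pmf.prob (erdos_renyi n (p n)) {E. ?bad n E}) \<longlonglongrightarrow> 0"
    by (intro prob_disj_tendsto_0 min_degree[OF p\<^sub>0' p_def] maxdeg discrepancy[OF p\<^sub>0' p_def K \<eta>] c)
  show "(\<lambda>n. measure_pmf.prob (erdos_renyi n (p n))
           {E. \<bar>von_neumann_entropy (gibbs_state \<tau> (laplacian_mat n E))\<bar> \<le> ?\<epsilon> n}) \<longlonglongrightarrow> 1"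
  proof (rule prob_tendsto_1[OF _ bad0])
    have "eventually (\<lambda>n. q * ln (real n) \<ge> 1) sequentially" using q by real_asymp
    then show "eventually (\<lambda>n. \<forall>E. E \<subseteq> vertex_pairs n \<longrightarrow> \<not> ?bad n E \<longrightarrow>
        \<bar>von_neumann_entropy (gibbs_state \<tau> (laplacian_mat n E))\<bar> \<le> ?\<epsilon> n) sequentially"
      using eventually_p[OF p\<^sub>0' p_def] eventually_ge_at_top[of 3]
    proof eventually_elim
      case (elim n)
      define L where "L = ln (real n)"
      have L: "L > 0" using elim by (simp add: L_def)
      have pn: "p n * n = p\<^sub>0 * L" using elim by (simp add: p_def L_def)
      show ?case
      proof (intro allI impI)
        fix E assume E: "E \<subseteq> vertex_pairs n" and good: "\<not> ?bad n E"
        have lower: "c * L \<le> deg E u" and upper: "deg E u \<le> K * L" if "u < n" for u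
          using good that unfolding L_def by force+
        have disc: "\<bar>\<Sum>u\<in>S. \<Sum>v\<in>T. centred (p n) E u v\<bar> \<le> \<eta> * L * sqrt (card S * card T)"
          if "S \<subseteq> {..<n}" "T \<subseteq> {..<n}" for S T
        proof (rule ccontr)
          assume "\<not> ?thesis"
          then have "\<eta> * L * sqrt (card S * card T) < \<bar>\<Sum>u\<in>S. \<Sum>v\<in>T. centred (p n) E u v\<bar>" by simp
          then show False using good that upper unfolding L_def by blast
        qed
        have gap: "lap_form n E x \<ge> (g * L) * (\<Sum>u<n. (x u)\<^sup>2)" if x: "(\<Sum>u<n. x u) = 0" for x :: "nat \<Rightarrow> real"
        proof -
          have up: "deg E u + p n * n \<le> (K + p\<^sub>0) * L" if "u < n" for u
            using upper[OF that] unfolding pn by (simp add: distrib_right)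
          have "2 * (\<eta> * L) * (2 * real \<gamma> + 1) + 4 * ((K + p\<^sub>0) * L) / 2 ^ \<gamma>
              = (2 * \<eta> * (2 * real \<gamma> + 1) + 4 * (K + p\<^sub>0) / 2 ^ \<gamma>) * L"
            by (simp add: field_simps)
          also have "\<dots> \<le> s * L"
          proof (rule mult_right_mono)
            show "2 * \<eta> * (2 * real \<gamma> + 1) + 4 * (K + p\<^sub>0) / 2 ^ \<gamma> \<le> s" using \<gamma> \<eta>2 by linarith
          qed (use L in simp)
          finally have "g * L \<le> c * L - (2 * (\<eta> * L) * (2 * real \<gamma> + 1) + 4 * ((K + p\<^sub>0) * L) / 2 ^ \<gamma>)"
            by (simp add: s_def algebra_simps)
          then have "(g * L) * (\<Sum>u<n. (x u)\<^sup>2) \<le>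
              (c * L - (2 * (\<eta> * L) * (2 * real \<gamma> + 1) + 4 * ((K + p\<^sub>0) * L) / 2 ^ \<gamma>)) * (\<Sum>u<n. (x u)\<^sup>2)"
            by (intro mult_right_mono sum_nonneg) auto
          also have "\<dots> \<le> lap_form n E x"
            by (rule laplacian_gap[OF E _ lower up disc]) (use elim \<eta> L K p\<^sub>0 x in auto)
          finally show ?thesis .
        qed
        have "\<tau> * (g * L) \<ge> 1" using elim by (simp add: q_def L_def mult.assoc)
        from laplacian_entropy_le[OF E _ \<tau> this gap] elim
        show "\<bar>von_neumann_entropy (gibbs_state \<tau> (laplacian_mat n E))\<bar> \<le> ?\<epsilon> n"
          by (simp add: q_def L_def mult.assoc)
      qed
    qed
  qed
qed

end

theorem mainTheorem6:
  fixes p\<^sub>0 \<tau> :: real and p :: "nat \<Rightarrow> real" and S :: "nat \<Rightarrow> nat set set \<Rightarrow> real"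
  assumes "p\<^sub>0 > 1" and "\<tau> > 0"
    and p_def: "\<And>n. p n = p\<^sub>0 * ln (real n) / real n"
    and S_def: "\<And>n E. S n E = von_neumann_entropy (gibbs_state \<tau> (laplacian_mat n E))"
  shows "(\<tau> < lambert_W0 ((1 - p\<^sub>0) / (exp 1 * p\<^sub>0)) / (1 - p\<^sub>0) \<longrightarrow>
           (\<exists>C. 0 < C \<and> C < 1 \<and>
             (\<exists>\<epsilon> :: nat \<Rightarrow> real. \<epsilon> \<longlonglongrightarrow> 0 \<and>
               (\<lambda>n. measure_pmf.prob (erdos_renyi n (p n))
                      {E. S n E \<ge> C * ln (real n) + \<epsilon> n}) \<longlonglongrightarrow> 1)))
       \<and> (\<tau> > lambert_Wm1 ((1 - p\<^sub>0) / (exp 1 * p\<^sub>0)) / (1 - p\<^sub>0) \<longrightarrow>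
           (\<exists>\<epsilon> :: nat \<Rightarrow> real. \<epsilon> \<longlonglongrightarrow> 0 \<and>
             (\<lambda>n. measure_pmf.prob (erdos_renyi n (p n))
                    {E. \<bar>S n E\<bar> \<le> \<epsilon> n}) \<longlonglongrightarrow> 1))"
proof (intro conjI impI)
  assume "\<tau> < lambert_W0 ((1 - p\<^sub>0) / (exp 1 * p\<^sub>0)) / (1 - p\<^sub>0)"
  then have "\<tau> * p\<^sub>0 < 1" using lambert_W0_threshold assms(1) by blast
  then obtain C where C: "0 < C" "C < 1" "(\<lambda>n. measure_pmf.prob (erdos_renyi n (p n))
           {E. von_neumann_entropy (gibbs_state \<tau> (laplacian_mat n E)) \<ge> C * ln (real n)}) \<longlonglongrightarrow> 1"
    using entropy_high_temperature[OF assms(1,2) p_def] by blast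
  have "(\<lambda>_. 0 :: real) \<longlonglongrightarrow> 0 \<and> (\<lambda>n. measure_pmf.prob (erdos_renyi n (p n)) {E. S n E \<ge> C * ln (real n) + 0}) \<longlonglongrightarrow> 1"
    using C(3) by (simp add: S_def)
  then show "\<exists>C. 0 < C \<and> C < 1 \<and> (\<exists>\<epsilon> :: nat \<Rightarrow> real. \<epsilon> \<longlonglongrightarrow> 0 \<and>
      (\<lambda>n. measure_pmf.prob (erdos_renyi n (p n)) {E. S n E \<ge> C * ln (real n) + \<epsilon> n}) \<longlonglongrightarrow> 1)"
    using C(1,2) by (intro exI[of _ C] exI[of _ "\<lambda>_. 0"] conjI) auto
next
  assume "\<tau> > lambert_Wm1 ((1 - p\<^sub>0) / (exp 1 * p\<^sub>0)) / (1 - p\<^sub>0)"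
  with assms(1) obtain c where "0 < c" "c < p\<^sub>0" "\<tau> * c > 1" "1 + c * ln (p\<^sub>0 / c) - p\<^sub>0 + c < 0"
    by (rule lambert_Wm1_threshold)
  then show "\<exists>\<epsilon> :: nat \<Rightarrow> real. \<epsilon> \<longlonglongrightarrow> 0 \<and>
      (\<lambda>n. measure_pmf.prob (erdos_renyi n (p n)) {E. \<bar>S n E\<bar> \<le> \<epsilon> n}) \<longlonglongrightarrow> 1"
    unfolding S_def by (rule entropy_low_temperature[OF assms(1,2) p_def])
qed

end
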